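(* Let $V$ be a $p$-dimensional real inner product space and $\mathbf A=(A_1,\dots,A_q)\in\mathrm{End}(V)^q$ a system of endomorphisms of $V$. Then there exists a unique generalized Newton transformation $T=(T_u : u\in\mathbb N(q))$ of $\mathbf A$. Moreover, each $T_u$ is given by $$T_u=\sum_{s=0}^{|u|}\ \sum_{\mathbf i\in\mathbb I(q,s)}(-1)^{\|\mathbf i\|}\,\sigma_{u-|\mathbf i|}\,\mathbf A^{\mathbf i},$$ where $\sigma_{u-|\mathbf i|}=\sigma_{u-|\mathbf i|}(\mathbf A)$.
   Context: $\mathbb N=\{0,1,2,\dots\}$, and $\mathbb N(q)$ is the set of multi-indices $u=(u_1,\dots,u_q)$ with $u_\alpha\in\mathbb N$; $|u|=u_1+\dots+u_q$. For $t\in\mathbb R^q$ put $t^u=t_1^{u_1}\cdots t_q^{u_q}$ and $t\mathbf A=t_1A_1+\dots+t_qA_q$. The numbers $\sigma_u=\sigma_u(\mathbf A)$ are defined by $\det(1_V+t\mathbf A)=\sum_{|u|\le p}\sigma_u t^u$, with $\sigma_u=0$ if $|u|>p$ or if $u$ has a negative entry. For $\alpha\in\{1,\dots,q\}$, $\alpha_\flat(u)$ is obtained from $u$ by decreasing $u_\alpha$ by $1$. A generalized Newton transformation of $\mathbf A$ is a family $(T_u)_{u\in\mathbb N(q)}$ of endomorphisms of $V$ such that for every $u\in\mathbb N(q)$ and every smooth curve $\tau\mapsto\mathbf A(\tau)=(A_1(\tau),\dots,A_q(\tau))$ in $\mathrm{End}(V)^q$ with $\mathbf A(0)=\mathbf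 A$, $$\frac{d}{d\tau}\Big|_{\tau=0}\sigma_u(\mathbf A(\tau))=\sum_{\alpha=1}^q\mathrm{tr}\Big(\frac{d}{d\tau}\Big|_{\tau=0}A_\alpha(\tau)\cdot T_{\alpha_\flat(u)}\Big),$$ where $T_w:=0$ if $w$ has a negative entry. For $s\ge1$, $\mathbb I(q,s)$ is the set of $q\times s$ matrices $\mathbf i=(i^\alpha_l)$ with entries in $\{0,1\}$ having exactly one entry equal to $1$ in every column. For $\mathbf i\in\mathbb I(q,s)$, $|\mathbf i|=(\sum_l i^1_l,\dots,\sum_l i^q_l)\in\mathbb N(q)$ is the vector of row sums, $\|\mathbf i\|=\sum_{\alpha,l}i^\alpha_l=s$, and $\mathbf A^{\mathbf i}=A_1^{i^1_1}\cdots A_q^{i^q_1}A_1^{i^1_2}\cdots A_q^{i^q_2}\cdots A_1^{i^1_s}\cdots A_q^{i^q_s}$ (composition; i.e. $A_{\alpha_1}\cdots A_{\alpha_s}$ if the entry $1$ of column $l$ lies in row $\alpha_l$). $\mathbb I(q,0)$ consists of a single element $0$ with $|0|=(0,\dots,0)$, $\|0\|=0$, $\mathbf A^0=1_V$. *)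

theory Defs
  imports "HOL-Analysis.Analysis" "Jordan_Normal_Form.Determinant"
begin

hide_const (open) Matrix.orthogonal
hide_fact (open) Matrix.orthogonal_def

section \<open>Determinant and trace of an endomorphism\<close>

text \<open>
  The space \<open>V\<close> is a type \<open>'v :: real_inner\<close> with a finite basis; dimension 0 is allowed, which
  \<open>euclidean_space\<close> would exclude. All linear maps of such a space are bounded, so
  \<open>End(V)\<close> is the normed space \<open>'v \<Rightarrow>\<^sub>L 'v\<close>, with composition \<open>o\<^sub>L\<close> and unit \<open>id_blinfun\<close>.

  Determinant and trace are read off from the matrix in an orthonormal basis. The basis is picked by
  \<open>SOME\<close>; \<open>ex_orthonormal_basis\<close>, \<open>endo_det_eq\<close> and \<open>endo_trace_eq\<close> show that one exists and that
  the choice does not matter.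
\<close>

definition orthonormal_basis :: "'v::real_inner list \<Rightarrow> bool" where
  "orthonormal_basis bs \<longleftrightarrow>
     (\<forall>i<length bs. \<forall>j<length bs. inner (bs ! i) (bs ! j) = (if i = j then 1 else 0)) \<and>
     span (set bs) = UNIV"

definition endo_mat :: "'v::real_inner list \<Rightarrow> ('v \<Rightarrow>\<^sub>L 'v) \<Rightarrow> real mat" where
  "endo_mat bs f =
     Matrix.mat (length bs) (length bs) (\<lambda>(i, j). inner (bs ! i) (blinfun_apply f (bs ! j)))"

definition endo_det :: "('v::real_inner \<Rightarrow>\<^sub>L 'v) \<Rightarrow> real" where
  "endo_det f = Determinant.det (endo_mat (SOME bs. orthonormal_basis bs) f)"

definition endo_trace :: "('v::real_inner \<Rightarrow>\<^sub>L 'v) \<Rightarrow> real" where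
  "endo_trace f = (let M = endo_mat (SOME bs. orthonormal_basis bs) f in \<Sum>i<dim_row M. M $$ (i, i))"

lemma ex_orthonormal_basis:
  fixes B :: "'v::real_inner set"
  assumes "finite B" "span B = UNIV"
  shows "\<exists>bs::'v list. orthonormal_basis bs"
proof -
  obtain C :: "'v set" where C: "finite C" "span C = span B" "pairwise orthogonal C"
    using basis_orthogonal[OF assms(1)] by blast
  define D where "D = (\<lambda>x. x /\<^sub>R norm x) ` (C - {0})"
  have sub: "x \<in> span D" if "x \<in> C" for x
  proof (cases "x = 0")
    case True
    then show ?thesis by (simp add: span_zero)
  next
    case False
    then have "x /\<^sub>R norm x \<in> D" using that by (auto simp: D_def)
    then have "norm x *\<^sub>R (x /\<^sub>R norm x) \<in> span D" by (intro span_scale span_base)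
    then show ?thesis using False by simp
  qed
  have "span C \<subseteq> span D"
    by (rule span_minimal) (use sub in auto)
  then have D_span: "span D = UNIV" using C(2) assms(2) by auto
  have norm1: "inner x x = 1" if "x \<in> D" for x
    using that unfolding norm_eq_1[symmetric] by (auto simp: D_def field_simps split: if_splits)
  have orth: "inner x y = 0" if "x \<in> D" "y \<in> D" "x \<noteq> y" for x y
  proof -
    obtain a where a: "x = a /\<^sub>R norm a" "a \<in> C"
      using \<open>x \<in> D\<close> by (auto simp: D_def)
    obtain b where b: "y = b /\<^sub>R norm b" "b \<in> C"
      using \<open>y \<in> D\<close> by (auto simp: D_def)
    have "a \<noteq> b" using a b \<open>x \<noteq> y\<close> by auto
    then have "orthogonal a b" using pairwiseD[OF C(3) a(2) b(2)] by simp
    then show ?thesis by (simp add: a b orthogonal_def)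
  qed
  have "finite D" using C(1) by (simp add: D_def)
  then obtain bs where bs: "set bs = D" "distinct bs"
    using finite_distinct_list by blast
  have "orthonormal_basis bs"
    unfolding orthonormal_basis_def
  proof (intro conjI allI impI)
    fix i j assume ij: "i < length bs" "j < length bs"
    then have "bs ! i \<in> D" "bs ! j \<in> D" using bs(1) nth_mem by blast+
    then show "inner (bs ! i) (bs ! j) = (if i = j then 1 else 0)"
      using norm1 orth nth_eq_iff_index_eq[OF bs(2) ij] by auto
  qed (simp add: bs(1) D_span)
  then show ?thesis by blast
qed

lemma orthonormal_basis_expand:
  assumes "orthonormal_basis bs"
  shows "(\<Sum>i<length bs. inner (bs ! i) v *\<^sub>R bs ! i) = v"
proof -
  let ?h = "\<lambda>v. \<Sum>i<length bs. inner (bs ! i) v *\<^sub>R bs ! i"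
  have on: "\<And>i j. i < length bs \<Longrightarrow> j < length bs \<Longrightarrow>
      inner (bs ! i) (bs ! j) = (if i = j then 1 else 0)"
    and sp: "v \<in> span (set bs)"
    using assms by (auto simp: orthonormal_basis_def)
  have lin: "linear ?h"
  proof (rule linearI)
    show "?h (x + y) = ?h x + ?h y" for x y
      by (simp only: inner_add_right scaleR_add_left sum.distrib)
    show "?h (r *\<^sub>R x) = r *\<^sub>R ?h x" for r x
      by (simp only: inner_scaleR_right scaleR_sum_right scaleR_scaleR)
  qed
  have "?h b = id b" if "b \<in> set bs" for b
  proof -
    obtain j where j: "j < length bs" "bs ! j = b"
      using \<open>b \<in> set bs\<close> by (auto simp: in_set_conv_nth)
    have "?h b = (\<Sum>i<length bs. if i = j then bs ! i else 0)"
      using on[OF _ j(1)] unfolding j(2) by (intro sum.cong) auto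
    then show ?thesis using j by simp
  qed
  then have "?h v = id v"
    by (rule linear_eq_on_span[OF lin linear_id _ sp])
  then show ?thesis by simp
qed

lemma orthonormal_basis_parseval:
  assumes "orthonormal_basis bs"
  shows "(\<Sum>i<length bs. inner x (bs ! i) * inner (bs ! i) y) = inner x y"
proof -
  have "inner x y = inner x (\<Sum>i<length bs. inner (bs ! i) y *\<^sub>R bs ! i)"
    by (simp add: orthonormal_basis_expand[OF assms])
  also have "\<dots> = (\<Sum>i<length bs. inner x (bs ! i) * inner (bs ! i) y)"
    unfolding inner_sum_right inner_scaleR_right by (intro sum.cong refl mult.commute)
  finally show ?thesis by simp
qed

lemma orthonormal_basis_dim:
  fixes bs :: "'v::real_inner list"
  assumes "orthonormal_basis bs"
  shows "length bs = dim (UNIV :: 'v set)"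
proof -
  have on: "\<And>i j. i < length bs \<Longrightarrow> j < length bs \<Longrightarrow>
      inner (bs ! i) (bs ! j) = (if i = j then 1 else 0)"
    and sp: "span (set bs) = UNIV"
    using assms by (auto simp: orthonormal_basis_def)
  have dist: "distinct bs"
    unfolding distinct_conv_nth
  proof (intro allI impI)
    fix i j assume "i < length bs" "j < length bs" "i \<noteq> j"
    then show "bs ! i \<noteq> bs ! j" using on[of i j] on[of i i] by auto
  qed
  have "pairwise orthogonal (set bs)"
  proof (rule pairwiseI)
    fix x y assume "x \<in> set bs" "y \<in> set bs" "x \<noteq> y"
    then obtain i j where ij: "i < length bs" "j < length bs" "bs ! i = x" "bs ! j = y"
      by (auto simp: in_set_conv_nth)
    then show "orthogonal x y"
      using on[OF ij(1,2)] \<open>x \<noteq> y\<close> by (auto simp: orthogonal_def split: if_splits)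
  qed
  moreover have "0 \<notin> set bs"
  proof
    assume "0 \<in> set bs"
    then obtain i where "i < length bs" "bs ! i = 0" by (auto simp: in_set_conv_nth)
    then show False using on[of i i] by simp
  qed
  ultimately have "independent (set bs)"
    by (rule pairwise_orthogonal_independent)
  then have "dim (UNIV :: 'v set) = card (set bs)"
    using sp by (metis dim_eq_card_independent dim_span)
  then show ?thesis using dist by (simp add: distinct_card)
qed

lemma endo_mat_change_basis:
  assumes bs: "orthonormal_basis bs" and cs: "orthonormal_basis cs"
  obtains P where "P \<in> carrier_mat (length bs) (length bs)"
    "Determinant.det P \<noteq> 0"
    "endo_mat bs f * P = P * endo_mat cs f"
proof -
  let ?n = "length bs"
  have len: "length cs = ?n"
    using bs cs orthonormal_basis_dim by metis
  define P where "P = Matrix.mat ?n ?n (\<lambda>(i, j). inner (bs ! i) (cs ! j))"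
  define Q where "Q = Matrix.mat ?n ?n (\<lambda>(i, j). inner (cs ! i) (bs ! j))"
  have PC: "P \<in> carrier_mat ?n ?n" and QC: "Q \<in> carrier_mat ?n ?n"
    by (auto simp: P_def Q_def)
  have "P * Q = 1\<^sub>m ?n"
  proof (rule eq_matI)
    fix i j assume "i < dim_row (1\<^sub>m ?n)" "j < dim_col (1\<^sub>m ?n)"
    then show "(P * Q) $$ (i, j) = 1\<^sub>m ?n $$ (i, j)"
      using orthonormal_basis_parseval[OF cs, of "bs ! i" "bs ! j"] bs
      by (simp add: P_def Q_def scalar_prod_def len atLeast0LessThan orthonormal_basis_def)
  qed (auto simp: P_def Q_def)
  then have "Determinant.det P * Determinant.det Q = 1"
    using Determinant.det_mult[OF PC QC] by simp
  then have det0: "Determinant.det P \<noteq> 0" by auto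
  have "endo_mat bs f * P = P * endo_mat cs f"
  proof (rule eq_matI)
    fix i j assume "i < dim_row (P * endo_mat cs f)" "j < dim_col (P * endo_mat cs f)"
    then have ij: "i < ?n" "j < ?n" by (auto simp: P_def endo_mat_def len)
    have "(endo_mat bs f * P) $$ (i, j) =
        (\<Sum>k<?n. inner (bs ! i) (blinfun_apply f (bs ! k)) * inner (bs ! k) (cs ! j))"
      using ij by (simp add: P_def endo_mat_def scalar_prod_def atLeast0LessThan)
    also have "\<dots> = inner (bs ! i)
        (blinfun_apply f (\<Sum>k<?n. inner (bs ! k) (cs ! j) *\<^sub>R bs ! k))"
      by (simp add: blinfun.sum_right blinfun.scaleR_right inner_sum_right mult.commute)
    also have "\<dots> = inner (bs ! i) (blinfun_apply f (cs ! j))"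
      by (simp add: orthonormal_basis_expand[OF bs])
    also have "\<dots> = (\<Sum>k<?n. inner (bs ! i) (cs ! k) * inner (cs ! k) (blinfun_apply f (cs ! j)))"
      using orthonormal_basis_parseval[OF cs] by (simp add: len)
    also have "\<dots> = (P * endo_mat cs f) $$ (i, j)"
      using ij by (simp add: P_def endo_mat_def scalar_prod_def atLeast0LessThan len)
    finally show "(endo_mat bs f * P) $$ (i, j) = (P * endo_mat cs f) $$ (i, j)" .
  qed (auto simp: P_def endo_mat_def len)
  with PC det0 show thesis by (rule that)
qed

lemma endo_det_eq:
  fixes bs :: "'v::real_inner list"
  assumes "orthonormal_basis bs"
  shows "endo_det f = Determinant.det (endo_mat bs f)"
proof -
  define cs where "cs = (SOME bs :: 'v list. orthonormal_basis bs)"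
  have cs: "orthonormal_basis cs" unfolding cs_def using assms by (rule someI)
  have len: "length cs = length bs"
    using assms cs orthonormal_basis_dim by metis
  obtain P where P: "P \<in> carrier_mat (length bs) (length bs)" "Determinant.det P \<noteq> 0"
    "endo_mat bs f * P = P * endo_mat cs f"
    using endo_mat_change_basis[OF assms cs] by metis
  have carr: "endo_mat bs f \<in> carrier_mat (length bs) (length bs)"
    "endo_mat cs f \<in> carrier_mat (length bs) (length bs)"
    by (auto simp: endo_mat_def len)
  have "Determinant.det (endo_mat bs f) * Determinant.det P
      = Determinant.det P * Determinant.det (endo_mat cs f)"
    using P(3) by (simp only: Determinant.det_mult[OF carr(1) P(1), symmetric]
        Determinant.det_mult[OF P(1) carr(2), symmetric])
  then show ?thesis using P(2) by (simp add: endo_det_def cs_def)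
qed

lemma endo_trace_eq:
  fixes bs :: "'v::real_inner list"
  assumes "orthonormal_basis bs"
  shows "endo_trace f = (\<Sum>i<length bs. inner (bs ! i) (blinfun_apply f (bs ! i)))"
proof -
  define cs where "cs = (SOME bs :: 'v list. orthonormal_basis bs)"
  have cs: "orthonormal_basis cs" unfolding cs_def using assms by (rule someI)
  have "endo_trace f = (\<Sum>i<length cs. inner (cs ! i) (blinfun_apply f (cs ! i)))"
    by (simp add: endo_trace_def endo_mat_def Let_def cs_def)
  also have "\<dots> = (\<Sum>i<length cs. \<Sum>j<length bs.
      inner (cs ! i) (bs ! j) * inner (bs ! j) (blinfun_apply f (cs ! i)))"
    by (simp add: orthonormal_basis_parseval[OF assms])
  also have "\<dots> = (\<Sum>j<length bs. \<Sum>i<length cs.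
      inner (bs ! j) (inner (cs ! i) (bs ! j) *\<^sub>R blinfun_apply f (cs ! i)))"
    by (subst sum.swap) simp
  also have "\<dots> = (\<Sum>j<length bs.
      inner (bs ! j) (blinfun_apply f (\<Sum>i<length cs. inner (cs ! i) (bs ! j) *\<^sub>R cs ! i)))"
    by (simp add: blinfun.sum_right blinfun.scaleR_right inner_sum_right)
  also have "\<dots> = (\<Sum>j<length bs. inner (bs ! j) (blinfun_apply f (bs ! j)))"
    by (simp add: orthonormal_basis_expand[OF cs])
  finally show ?thesis .
qed


section \<open>Multi-indices and the numbers \<open>\<sigma>\<^sub>u\<close>\<close>

text \<open>
  A finite type \<open>'q\<close> stands for \<open>{1, \<dots>, q}\<close>. Families over \<open>\<nat>(q)\<close> are indexed by
  \<open>'q \<Rightarrow> nat\<close>; indices that may have negative entries have type \<open>'q \<Rightarrow> int\<close>, and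
  \<open>ext_zero\<close> carries the convention that such entries give 0.
\<close>

definition ext_zero :: "(('q \<Rightarrow> nat) \<Rightarrow> 'b::zero) \<Rightarrow> ('q \<Rightarrow> int) \<Rightarrow> 'b" where
  "ext_zero F w = (if \<forall>\<alpha>. 0 \<le> w \<alpha> then F (\<lambda>\<alpha>. nat (w \<alpha>)) else 0)"

definition mdeg :: "('q::finite \<Rightarrow> nat) \<Rightarrow> nat" where
  "mdeg u = (\<Sum>\<alpha>\<in>UNIV. u \<alpha>)"

definition flat :: "'q \<Rightarrow> ('q \<Rightarrow> nat) \<Rightarrow> 'q \<Rightarrow> int" where
  "flat \<alpha> u = (\<lambda>\<beta>. if \<beta> = \<alpha> then int (u \<beta>) - 1 else int (u \<beta>))"

text \<open>The coefficients of \<open>det (1 + t A)\<close> as a polynomial function of \<open>t \<in> \<real>\<^sup>q\<close>.\<close>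

definition sigma_nat :: "('q::finite \<Rightarrow> 'v::real_inner \<Rightarrow>\<^sub>L 'v) \<Rightarrow> ('q \<Rightarrow> nat) \<Rightarrow> real" where
  "sigma_nat A = (THE c.
     (\<forall>u. mdeg u > dim (UNIV :: 'v set) \<longrightarrow> c u = 0) \<and>
     (\<forall>t :: 'q \<Rightarrow> real. endo_det (id_blinfun + (\<Sum>\<alpha>\<in>UNIV. t \<alpha> *\<^sub>R A \<alpha>)) =
        (\<Sum>u | mdeg u \<le> dim (UNIV :: 'v set). c u * (\<Prod>\<alpha>\<in>UNIV. t \<alpha> ^ u \<alpha>))))"

definition sigma_int :: "('q::finite \<Rightarrow> 'v::real_inner \<Rightarrow>\<^sub>L 'v) \<Rightarrow> ('q \<Rightarrow> int) \<Rightarrow> real" where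
  "sigma_int A = ext_zero (sigma_nat A)"


section \<open>Generalized Newton transformations\<close>

text \<open>For open \<open>S\<close>, this says that \<open>c\<close> is \<open>C\<^sup>\<infinity>\<close> on \<open>S\<close>; \<open>D n\<close> is the \<open>n\<close>-th derivative.\<close>

definition smooth_curve_on :: "real set \<Rightarrow> (real \<Rightarrow> 'b::real_normed_vector) \<Rightarrow> bool" where
  "smooth_curve_on S c \<longleftrightarrow> (\<exists>D :: nat \<Rightarrow> real \<Rightarrow> 'b. (\<forall>\<tau>\<in>S. D 0 \<tau> = c \<tau>) \<and>
     (\<forall>n. \<forall>\<tau>\<in>S. (D n has_vector_derivative D (Suc n) \<tau>) (at \<tau>)))"

definition generalized_newton_transformation ::
  "('q::finite \<Rightarrow> 'v::real_inner \<Rightarrow>\<^sub>L 'v) \<Rightarrow> (('q \<Rightarrow> nat) \<Rightarrow> 'v \<Rightarrow>\<^sub>L 'v) \<Rightarrow> bool" where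
  "generalized_newton_transformation A T \<longleftrightarrow>
     (\<forall>u. \<forall>c :: real \<Rightarrow> 'q \<Rightarrow> 'v \<Rightarrow>\<^sub>L 'v. \<forall>\<epsilon>>0.
        (\<forall>\<alpha>. smooth_curve_on {-\<epsilon><..<\<epsilon>} (\<lambda>\<tau>. c \<tau> \<alpha>)) \<and> c 0 = A \<longrightarrow>
        ((\<lambda>\<tau>. sigma_int (c \<tau>) (\<lambda>\<alpha>. int (u \<alpha>))) has_real_derivative
           (\<Sum>\<alpha>\<in>UNIV. endo_trace
              (vector_derivative (\<lambda>\<tau>. c \<tau> \<alpha>) (at 0) o\<^sub>L ext_zero T (flat \<alpha> u)))) (at 0))"


section \<open>The matrices \<open>\<I>(q,s)\<close> and the products \<open>A\<^sup>i\<close>\<close>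

text \<open>
  Columns are numbered \<open>1, \<dots>, s\<close>; entries outside are 0, so that each \<open>q \<times> s\<close> matrix is one
  function. In particular \<open>index_mats 0\<close> has the single element \<open>\<lambda>_ _. 0\<close>.
\<close>

definition index_mats :: "nat \<Rightarrow> ('q \<Rightarrow> nat \<Rightarrow> nat) set" where
  "index_mats s = {i. (\<forall>\<alpha> l. i \<alpha> l \<in> {0, 1}) \<and> (\<forall>l\<in>{1..s}. \<exists>!\<alpha>. i \<alpha> l = 1) \<and>
     (\<forall>\<alpha> l. l \<notin> {1..s} \<longrightarrow> i \<alpha> l = 0)}"

definition row_sums :: "nat \<Rightarrow> ('q \<Rightarrow> nat \<Rightarrow> nat) \<Rightarrow> 'q \<Rightarrow> nat" where
  "row_sums s i = (\<lambda>\<alpha>. \<Sum>l=1..s. i \<alpha> l)"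

definition total_sum :: "nat \<Rightarrow> ('q::finite \<Rightarrow> nat \<Rightarrow> nat) \<Rightarrow> nat" where
  "total_sum s i = (\<Sum>\<alpha>\<in>UNIV. \<Sum>l=1..s. i \<alpha> l)"

text \<open>
  Column \<open>l\<close> has exactly one entry 1, so its factor \<open>A\<^sub>1 ^ i\<^sub>1\<^sub>l \<cdots> A\<^sub>q ^ i\<^sub>q\<^sub>l\<close> is \<open>A \<alpha>\<close> for the row \<open>\<alpha>\<close>
  of that entry; no order on \<open>'q\<close> is needed.
\<close>

definition endo_prod ::
  "('q \<Rightarrow> 'v::real_inner \<Rightarrow>\<^sub>L 'v) \<Rightarrow> nat \<Rightarrow> ('q \<Rightarrow> nat \<Rightarrow> nat) \<Rightarrow> 'v \<Rightarrow>\<^sub>L 'v" where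
  "endo_prod A s i =
     foldr (\<lambda>l F. A (THE \<alpha>. i \<alpha> l = 1) o\<^sub>L F) [1..<Suc s] id_blinfun"

end

theory Submission
  imports Defs
begin

text \<open>
  The generalized Newton transformation consists of the coefficients of the adjugate of the pencil
  \<open>1 + tA\<close>. The entries of this adjugate are polynomials in \<open>t\<close>, so it can be written as
  \<open>\<Sum>\<^sub>w T\<^sub>w t\<^sup>w\<close> with endomorphisms \<open>T\<^sub>w\<close> (\<open>ex_adjugate_coeffs\<close>). Two classical identities for the
  adjugate, compared coefficient by coefficient in \<open>t\<close>, give everything else.

  Jacobi's formula for the derivative of a determinant (\<open>det_has_derivative\<close>) says that, at \<open>\<tau> = 0\<close>,
  \<open>d/d\<tau> det (1 + t A(\<tau>)) = tr (t A' adj (1 + tA))\<close>, that is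
  \<open>\<Sum>\<^sub>u \<sigma>\<^sub>u' t\<^sup>u = \<Sum>\<^sub>\<alpha> \<Sum>\<^sub>w tr (A\<^sub>\<alpha>' T\<^sub>w) t\<^sub>\<alpha> t\<^sup>w\<close>. The coefficient of \<open>t\<^sup>u\<close> is the defining property of a
  generalized Newton transformation (\<open>adjugate_coeffs_newton\<close>). Differentiation and the extraction of
  coefficients commute because the \<open>\<sigma>\<^sub>u(A(\<tau>))\<close> arise from the entries of \<open>A(\<tau>)\<close> by sums and products;
  this is recorded in the notion of a polynomial family.

  Cramer's rule \<open>(1 + tA) adj (1 + tA) = det (1 + tA) 1\<close> becomes the recursion
  \<open>T\<^sub>u = \<sigma>\<^sub>u 1 - \<Sum>\<^sub>\<alpha> A\<^sub>\<alpha> T\<^sub>v\<close> (\<open>adjugate_coeffs_rec\<close>), where \<open>v\<close> is \<open>u\<close> with its entry at \<open>\<alpha>\<close> decreased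
  by one. Each application lowers the degree of the index, so unrolling it (\<open>ext_zero_unroll\<close>) stops
  after \<open>|u| + 1\<close> levels, and level \<open>s\<close> is a sum over the words \<open>\<alpha>\<^sub>1 \<dots> \<alpha>\<^sub>s\<close>, that is, over \<open>\<I>(q,s)\<close>.

  Uniqueness holds for an independent reason (\<open>newton_unique\<close>): along the line \<open>A + \<tau> B\<close> with \<open>B\<close> in a
  single component, the defining property prescribes \<open>tr (B T\<^sub>w)\<close> for all \<open>B\<close>, and the trace form is
  nondegenerate.
\<close>


section \<open>Polynomial functions of several variables\<close>

definition mpow :: "('q::finite \<Rightarrow> real) \<Rightarrow> ('q \<Rightarrow> nat) \<Rightarrow> real" where
  "mpow t u = (\<Prod>\<alpha>\<in>UNIV. t \<alpha> ^ u \<alpha>)"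

definition poly_eval :: "nat \<Rightarrow> (('q::finite \<Rightarrow> nat) \<Rightarrow> real) \<Rightarrow> ('q \<Rightarrow> real) \<Rightarrow> real" where
  "poly_eval d c t = (\<Sum>u | mdeg u \<le> d. c u * mpow t u)"

lemma finite_mdeg_le [simp]: "finite {u :: 'q::finite \<Rightarrow> nat. mdeg u \<le> d}"
proof (rule finite_subset)
  show "{u :: 'q \<Rightarrow> nat. mdeg u \<le> d} \<subseteq> PiE UNIV (\<lambda>_. {..d})"
  proof clarify
    fix u :: "'q \<Rightarrow> nat" assume "mdeg u \<le> d"
    moreover have "u \<alpha> \<le> mdeg u" for \<alpha>
      unfolding mdeg_def by (rule member_le_sum) auto
    ultimately show "u \<in> PiE UNIV (\<lambda>_. {..d})"
      by (auto simp: PiE_UNIV_domain intro: order_trans)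
  qed
qed (simp add: finite_PiE)

lemma mpow_add: "mpow t (\<lambda>\<alpha>. u \<alpha> + v \<alpha>) = mpow t u * mpow t v"
  by (simp add: mpow_def power_add prod.distrib)

lemma mdeg_add: "mdeg (\<lambda>\<alpha>. u \<alpha> + v \<alpha>) = mdeg u + mdeg v"
  by (simp add: mdeg_def sum.distrib)

lemma mdeg_unit [simp]: "mdeg (\<lambda>\<beta>. if \<beta> = \<alpha> then 1 else 0 :: nat) = 1"
  by (simp add: mdeg_def)

lemma mpow_unit [simp]: "mpow t (\<lambda>\<beta>. if \<beta> = \<alpha> then 1 else 0 :: nat) = t \<alpha>"
proof -
  have "mpow t (\<lambda>\<beta>. if \<beta> = \<alpha> then 1 else 0 :: nat) = (\<Prod>\<beta>\<in>UNIV. if \<beta> = \<alpha> then t \<beta> else 1)"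
    unfolding mpow_def by (intro prod.cong) auto
  then show ?thesis by simp
qed

lemma mpow_zero [simp]: "mpow t (\<lambda>_. 0) = 1"
  by (simp add: mpow_def)

lemma ext_zero_nat [simp]: "ext_zero F (\<lambda>\<alpha>. int (u \<alpha>)) = F u"
  by (simp add: ext_zero_def)

lemma ext_zero_map: "\<phi> 0 = 0 \<Longrightarrow> ext_zero (\<lambda>w. \<phi> (F w)) v = \<phi> (ext_zero F v)"
  by (simp add: ext_zero_def)

lemma ext_zero_flat:
  "ext_zero F (flat \<alpha> u) = (if u \<alpha> = 0 then 0 else F (u(\<alpha> := u \<alpha> - 1)))"
proof -
  have "(\<lambda>\<beta>. nat (flat \<alpha> u \<beta>)) = u(\<alpha> := u \<alpha> - 1)" if "u \<alpha> \<noteq> 0"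
    using that by (auto simp: flat_def fun_eq_iff nat_diff_distrib)
  then show ?thesis by (auto simp: ext_zero_def flat_def)
qed

lemma mdeg_decr:
  assumes "u \<alpha> \<noteq> 0"
  shows "mdeg u = Suc (mdeg (u(\<alpha> := u \<alpha> - 1)))"
proof -
  have "mdeg v = v \<alpha> + (\<Sum>\<beta>\<in>UNIV - {\<alpha>}. v \<beta>)" for v
    unfolding mdeg_def by (rule sum.remove) auto
  from this[of u] this[of "u(\<alpha> := u \<alpha> - 1)"] show ?thesis using assms by simp
qed

lemma ext_zero_flat_vanish:
  assumes "\<And>w. d < mdeg w \<Longrightarrow> F w = 0" "Suc d < mdeg u"
  shows "ext_zero F (flat \<alpha> u) = 0"
proof (cases "u \<alpha> = 0")
  case False
  then have "d < mdeg (u(\<alpha> := u \<alpha> - 1))" using assms(2) mdeg_decr[of u \<alpha>] by linarith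
  then show ?thesis unfolding ext_zero_flat by (simp only: assms(1) if_cancel)
qed (simp add: ext_zero_flat)

lemma poly_eval_mono:
  assumes "\<And>u. d < mdeg u \<Longrightarrow> c u = 0" "d \<le> d'"
  shows "poly_eval d' c t = poly_eval d c t"
  unfolding poly_eval_def
  by (rule sum.mono_neutral_right) (use assms in \<open>auto simp: not_le\<close>)

lemma poly_eval_diff: "poly_eval d (\<lambda>u. a u - b u) t = poly_eval d a t - poly_eval d b t"
  by (simp add: poly_eval_def sum_subtractf left_diff_distrib)

lemma poly_eval_add: "poly_eval d (\<lambda>u. a u + b u) t = poly_eval d a t + poly_eval d b t"
  by (simp add: poly_eval_def sum.distrib distrib_right)

lemma poly_eval_sum: "poly_eval d (\<lambda>u. \<Sum>i\<in>I. a i u) t = (\<Sum>i\<in>I. poly_eval d (a i) t)"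
  unfolding poly_eval_def by (subst sum.swap) (simp add: sum_distrib_right)

lemma poly_eval_cmult: "poly_eval d (\<lambda>u. k * a u) t = k * poly_eval d a t"
  by (simp add: poly_eval_def sum_distrib_left mult.assoc)

text \<open>
  The convolution of the coefficients, kept as a sum over pairs of indices: it is then visibly a
  finite sum of products, which preserves differentiability in a parameter.
\<close>

lemma poly_eval_mult:
  "poly_eval d a t * poly_eval e b t =
     poly_eval (d + e) (\<lambda>w. \<Sum>u | mdeg u \<le> d. \<Sum>v | mdeg v \<le> e.
       if w = (\<lambda>\<alpha>. u \<alpha> + v \<alpha>) then a u * b v else 0) t"
proof -
  have "poly_eval (d + e) (\<lambda>w. if w = (\<lambda>\<alpha>. u \<alpha> + v \<alpha>) then a u * b v else 0) t =
      (a u * mpow t u) * (b v * mpow t v)" if "mdeg u \<le> d" "mdeg v \<le> e" for u v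
  proof -
    have "poly_eval (d + e) (\<lambda>w. if w = (\<lambda>\<alpha>. u \<alpha> + v \<alpha>) then a u * b v else 0) t =
      (\<Sum>w | mdeg w \<le> d + e. if w = (\<lambda>\<alpha>. u \<alpha> + v \<alpha>) then a u * b v * mpow t w else 0)"
      unfolding poly_eval_def by (intro sum.cong) auto
    also have "\<dots> = a u * b v * mpow t (\<lambda>\<alpha>. u \<alpha> + v \<alpha>)"
      using that by (simp add: mdeg_add)
    finally show ?thesis by (simp add: mpow_add)
  qed
  then show ?thesis
    by (simp add: poly_eval_sum) (simp add: poly_eval_def sum_product)
qed

text \<open>
  Multiplication by a variable moves every coefficient up by one step, so the coefficient at \<open>u\<close>
  comes from the index \<open>flat \<alpha> u\<close>; the zero convention for negative entries accounts for the
  monomials without \<open>t\<^sub>\<alpha>\<close>.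
\<close>

lemma poly_eval_shift:
  "t \<alpha> * poly_eval d c t = poly_eval (Suc d) (\<lambda>u. ext_zero c (flat \<alpha> u)) t"
proof -
  let ?up = "\<lambda>w \<beta>. w \<beta> + (if \<beta> = \<alpha> then 1 else 0 :: nat)"
  have flat_up: "ext_zero c (flat \<alpha> (?up w)) = c w" for w
  proof -
    have "(?up w)(\<alpha> := ?up w \<alpha> - 1) = w" by (auto simp: fun_eq_iff)
    then show ?thesis by (simp only: ext_zero_flat) simp
  qed
  have "poly_eval (Suc d) (\<lambda>u. ext_zero c (flat \<alpha> u)) t =
      (\<Sum>u\<in>?up ` {w. mdeg w \<le> d}. ext_zero c (flat \<alpha> u) * mpow t u)"
    unfolding poly_eval_def
  proof (rule sum.mono_neutral_right)
    show "?up ` {w. mdeg w \<le> d} \<subseteq> {u. mdeg u \<le> Suc d}"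
      by (auto simp only: mdeg_add mdeg_unit mem_Collect_eq)
    show "\<forall>u\<in>{u. mdeg u \<le> Suc d} - ?up ` {w. mdeg w \<le> d}. ext_zero c (flat \<alpha> u) * mpow t u = 0"
    proof
      fix u assume u: "u \<in> {u. mdeg u \<le> Suc d} - ?up ` {w. mdeg w \<le> d}"
      have "u \<alpha> = 0"
      proof (rule ccontr)
        assume "u \<alpha> \<noteq> 0"
        define w where "w = (\<lambda>\<beta>. if \<beta> = \<alpha> then u \<beta> - 1 else u \<beta>)"
        have uw: "u = ?up w" using \<open>u \<alpha> \<noteq> 0\<close> by (auto simp: w_def)
        then have "mdeg u = Suc (mdeg w)" by (metis mdeg_add mdeg_unit Suc_eq_plus1)
        with u uw show False by auto
      qed
      then show "ext_zero c (flat \<alpha> u) * mpow t u = 0"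
        by (simp add: ext_zero_flat)
    qed
  qed simp
  also have "\<dots> = (\<Sum>w | mdeg w \<le> d. c w * mpow t (?up w))"
  proof (subst sum.reindex)
    show "inj_on ?up {w. mdeg w \<le> d}"
      by (auto intro!: inj_onI simp: fun_eq_iff)
  qed (simp add: flat_up)
  also have "\<dots> = t \<alpha> * poly_eval d c t"
    unfolding mpow_add mpow_unit poly_eval_def by (simp add: sum_distrib_left mult_ac)
  finally show ?thesis by simp
qed

lemma poly_eval_monom:
  assumes "mdeg v \<le> d"
  shows "poly_eval d (\<lambda>u. if u = v then k else 0) t = k * mpow t v"
proof -
  have "poly_eval d (\<lambda>u. if u = v then k else 0) t =
      (\<Sum>u | mdeg u \<le> d. if u = v then k * mpow t u else 0)"
    unfolding poly_eval_def by (intro sum.cong) auto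
  then show ?thesis using assms by simp
qed

text \<open>
  Induction on the set \<open>S\<close> of variables: as a polynomial in the new variable alone, the function has
  vanishing coefficients, and these are polynomials in the old variables. The exponents need to be
  told apart only by their restrictions to \<open>S\<close>, which is what makes the induction go through with
  the multi-indices left unchanged.
\<close>

lemma vanishing_polynomial_coeffs:
  fixes c :: "('q::finite \<Rightarrow> nat) \<Rightarrow> real"
  assumes "finite S" "finite U"
    and "\<And>u v. u \<in> U \<Longrightarrow> v \<in> U \<Longrightarrow> (\<forall>\<alpha>\<in>S. u \<alpha> = v \<alpha>) \<Longrightarrow> u = v"
    and "\<And>t. (\<Sum>u\<in>U. c u * (\<Prod>\<alpha>\<in>S. t \<alpha> ^ u \<alpha>)) = 0"
    and "u \<in> U"
  shows "c u = 0"
  using assms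
proof (induction S arbitrary: U u rule: finite_induct)
  case empty
  then have "U = {u}" by auto
  then show ?case using empty.prems(3)[of "\<lambda>_. 0"] by simp
next
  case (insert a S)
  \<comment> \<open>Collect the terms by their exponent \<open>k\<close> in the new variable \<open>a\<close>.\<close>
  define V where "V = (\<lambda>k. {v\<in>U. v a = k})"
  define N where "N = Max ((\<lambda>u. u a) ` U)"
  have N: "v a \<le> N" if "v \<in> U" for v
    unfolding N_def using that insert.prems(1) by (intro Max_ge) auto
  have sub: "(\<Sum>v\<in>V k. c v * (\<Prod>\<alpha>\<in>S. t \<alpha> ^ v \<alpha>)) = 0" if "k \<le> N" for k t
  proof -
    have "\<forall>x. (\<Sum>k\<le>N. (\<Sum>v\<in>V k. c v * (\<Prod>\<alpha>\<in>S. t \<alpha> ^ v \<alpha>)) * x ^ k) = 0"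
    proof
      fix x
      let ?t = "\<lambda>\<alpha>. if \<alpha> = a then x else t \<alpha>"
      have t: "(\<Prod>\<alpha>\<in>insert a S. ?t \<alpha> ^ v \<alpha>) = (\<Prod>\<alpha>\<in>S. t \<alpha> ^ v \<alpha>) * x ^ v a" for v
      proof -
        have "(\<Prod>\<alpha>\<in>S. ?t \<alpha> ^ v \<alpha>) = (\<Prod>\<alpha>\<in>S. t \<alpha> ^ v \<alpha>)"
          using insert.hyps(2) by (intro prod.cong) auto
        then show ?thesis using insert.hyps by (simp add: mult.commute)
      qed
      have "(\<Sum>k\<le>N. (\<Sum>v\<in>V k. c v * (\<Prod>\<alpha>\<in>S. t \<alpha> ^ v \<alpha>)) * x ^ k) =
          (\<Sum>k\<le>N. \<Sum>v\<in>{v\<in>U. v a = k}. c v * (\<Prod>\<alpha>\<in>insert a S. ?t \<alpha> ^ v \<alpha>))"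
        unfolding t sum_distrib_right V_def by (intro sum.cong) (auto simp: mult.assoc)
      also have "\<dots> = (\<Sum>v\<in>U. c v * (\<Prod>\<alpha>\<in>insert a S. ?t \<alpha> ^ v \<alpha>))"
        by (rule sum.group) (use insert.prems(1) N in auto)
      also have "\<dots> = 0" by (rule insert.prems(3))
      finally show "(\<Sum>k\<le>N. (\<Sum>v\<in>V k. c v * (\<Prod>\<alpha>\<in>S. t \<alpha> ^ v \<alpha>)) * x ^ k) = 0" .
    qed
    then show ?thesis using that unfolding polyfun_eq_0 by blast
  qed
  show ?case
  proof (rule insert.IH[of "V (u a)" u])
    show "finite (V (u a))" using insert.prems(1) by (simp add: V_def)
    show "v = w" if "v \<in> V (u a)" "w \<in> V (u a)" "\<forall>\<alpha>\<in>S. v \<alpha> = w \<alpha>" for v w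
      by (rule insert.prems(2)) (use that in \<open>auto simp: V_def\<close>)
    show "(\<Sum>v\<in>V (u a). c v * (\<Prod>\<alpha>\<in>S. t \<alpha> ^ v \<alpha>)) = 0" for t
      by (rule sub) (use N insert.prems(4) in auto)
    show "u \<in> V (u a)" using insert.prems(4) by (simp add: V_def)
  qed
qed

lemma poly_coeffs_unique:
  assumes eq: "\<And>t. poly_eval d a t = poly_eval d b t"
    and van: "\<And>u. d < mdeg u \<Longrightarrow> a u = 0" "\<And>u. d < mdeg u \<Longrightarrow> b u = 0"
  shows "a u = b u"
proof (cases "mdeg u \<le> d")
  case True
  have "(\<Sum>u | mdeg u \<le> d. (a u - b u) * (\<Prod>\<alpha>\<in>UNIV. t \<alpha> ^ u \<alpha>)) = 0" for t
    using poly_eval_diff[of d a b t] eq[of t] by (simp add: poly_eval_def mpow_def)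
  then have "a u - b u = 0"
    by (rule vanishing_polynomial_coeffs[rotated 3]) (use True in auto)
  then show ?thesis by simp
qed (use van in auto)

section \<open>Families of polynomials with differentiable coefficients\<close>

text \<open>
  A one-parameter family of polynomials in \<open>t\<close> whose coefficients are differentiable functions of
  the parameter at \<open>x\<close>. Closure under sums and products makes it possible to differentiate the
  coefficients of a determinant without a formula for them. The coefficients have to vanish above
  the degree \<open>d\<close>, so that they are determined by the values and can be
  read off in any larger degree as well.
\<close>

definition poly_family ::
  "real \<Rightarrow> nat \<Rightarrow> (real \<Rightarrow> ('q::finite \<Rightarrow> real) \<Rightarrow> real) \<Rightarrow> bool" where
  "poly_family x d f \<longleftrightarrow> (\<exists>c. (\<forall>\<tau> u. d < mdeg u \<longrightarrow> c \<tau> u = 0) \<and>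
     (\<forall>\<tau> t. f \<tau> t = poly_eval d (c \<tau>) t) \<and> (\<forall>u. (\<lambda>\<tau>. c \<tau> u) differentiable (at x)))"

lemma poly_familyE:
  assumes "poly_family x d f"
  obtains c where "\<And>\<tau> u. d < mdeg u \<Longrightarrow> c \<tau> u = 0" "\<And>\<tau> t. f \<tau> t = poly_eval d (c \<tau>) t"
    "\<And>u. (\<lambda>\<tau>. c \<tau> u) differentiable (at x)"
  using assms unfolding poly_family_def by blast

lemma poly_family_coeff:
  assumes "k differentiable (at x)"
  shows "poly_family x d (\<lambda>\<tau> t. k \<tau>)"
  unfolding poly_family_def
proof (intro exI[of _ "\<lambda>\<tau> u. if u = (\<lambda>_. 0) then k \<tau> else 0"] conjI allI impI)
  show "(\<lambda>\<tau>. if u = (\<lambda>_. 0) then k \<tau> else 0) differentiable (at x)" for u :: "'a \<Rightarrow> nat"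
    using assms by (cases "u = (\<lambda>_. 0)") auto
qed (auto simp: poly_eval_monom mdeg_def)

lemma poly_family_const: "poly_family x d (\<lambda>\<tau> t. k)"
  by (rule poly_family_coeff) simp

lemma poly_family_var: "poly_family x 1 (\<lambda>\<tau> t. t \<alpha>)"
  unfolding poly_family_def
proof (intro exI[of _ "\<lambda>\<tau> u. if u = (\<lambda>\<beta>. if \<beta> = \<alpha> then 1 else 0) then 1 else 0"] conjI allI impI)
  show "t \<alpha> = poly_eval 1 (\<lambda>u. if u = (\<lambda>\<beta>. if \<beta> = \<alpha> then 1 else 0) then 1 else 0) t" for t
    by (subst poly_eval_monom) auto
qed (auto simp del: One_nat_def)

lemma poly_family_add:
  assumes "poly_family x d f" "poly_family x d g"
  shows "poly_family x d (\<lambda>\<tau> t. f \<tau> t + g \<tau> t)"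
proof -
  obtain a where a: "\<And>\<tau> u. d < mdeg u \<Longrightarrow> a \<tau> u = 0" "\<And>\<tau> t. f \<tau> t = poly_eval d (a \<tau>) t"
    "\<And>u. (\<lambda>\<tau>. a \<tau> u) differentiable (at x)"
    using poly_familyE[OF assms(1)] by blast
  obtain b where b: "\<And>\<tau> u. d < mdeg u \<Longrightarrow> b \<tau> u = 0" "\<And>\<tau> t. g \<tau> t = poly_eval d (b \<tau>) t"
    "\<And>u. (\<lambda>\<tau>. b \<tau> u) differentiable (at x)"
    using poly_familyE[OF assms(2)] by blast
  show ?thesis
    unfolding poly_family_def
    by (intro exI[of _ "\<lambda>\<tau> u. a \<tau> u + b \<tau> u"])
      (auto simp: a b poly_eval_add)
qed

lemma poly_family_mult:
  assumes "poly_family x d f" "poly_family x e g"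
  shows "poly_family x (d + e) (\<lambda>\<tau> t. f \<tau> t * g \<tau> t)"
proof -
  obtain a where a: "\<And>\<tau> u. d < mdeg u \<Longrightarrow> a \<tau> u = 0" "\<And>\<tau> t. f \<tau> t = poly_eval d (a \<tau>) t"
    "\<And>u. (\<lambda>\<tau>. a \<tau> u) differentiable (at x)"
    using poly_familyE[OF assms(1)] by blast
  obtain b where b: "\<And>\<tau> u. e < mdeg u \<Longrightarrow> b \<tau> u = 0" "\<And>\<tau> t. g \<tau> t = poly_eval e (b \<tau>) t"
    "\<And>u. (\<lambda>\<tau>. b \<tau> u) differentiable (at x)"
    using poly_familyE[OF assms(2)] by blast
  let ?c = "\<lambda>\<tau> w. \<Sum>u | mdeg u \<le> d. \<Sum>v | mdeg v \<le> e.
       if w = (\<lambda>\<alpha>. u \<alpha> + v \<alpha>) then a \<tau> u * b \<tau> v else 0"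
  show ?thesis
    unfolding poly_family_def
  proof (intro exI[of _ ?c] conjI allI impI)
    show "?c \<tau> w = 0" if "d + e < mdeg w" for \<tau> w
      using that by (intro sum.neutral ballI) (auto simp: mdeg_add)
    show "f \<tau> t * g \<tau> t = poly_eval (d + e) (?c \<tau>) t" for \<tau> t
      by (simp add: a(2) b(2) poly_eval_mult)
    have "(\<lambda>\<tau>. if w = (\<lambda>\<alpha>. u \<alpha> + v \<alpha>) then a \<tau> u * b \<tau> v else 0) differentiable (at x)" for u v w
      using a(3) b(3) by (cases "w = (\<lambda>\<alpha>. u \<alpha> + v \<alpha>)") auto
    then show "(\<lambda>\<tau>. ?c \<tau> w) differentiable (at x)" for w
      by (intro differentiable_sum) auto
  qed
qed

lemma poly_family_sum:
  assumes "\<And>i. i \<in> I \<Longrightarrow> poly_family x d (f i)"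
  shows "poly_family x d (\<lambda>\<tau> t. \<Sum>i\<in>I. f i \<tau> t)"
  using assms
proof (induction I rule: infinite_finite_induct)
  case (insert i I)
  then show ?case by (simp add: poly_family_add)
qed (auto intro: poly_family_const)

lemma poly_family_prod:
  assumes "finite I" "\<And>i. i \<in> I \<Longrightarrow> poly_family x d (f i)"
  shows "poly_family x (card I * d) (\<lambda>\<tau> t. \<Prod>i\<in>I. f i \<tau> t)"
  using assms
proof (induction I rule: finite_induct)
  case (insert i I)
  then show ?case using poly_family_mult[of x d "f i" "card I * d" "\<lambda>\<tau> t. \<Prod>i\<in>I. f i \<tau> t"]
    by simp
qed (auto intro: poly_family_const)

lemma poly_family_det:
  assumes "\<And>\<tau> t. M \<tau> t \<in> carrier_mat n n"
    and "\<And>i j. i < n \<Longrightarrow> j < n \<Longrightarrow> poly_family x 1 (\<lambda>\<tau> t. M \<tau> t $$ (i, j))"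
  shows "poly_family x n (\<lambda>\<tau> t. Determinant.det (M \<tau> t))"
proof -
  have "poly_family x n (\<lambda>\<tau> t. \<Sum>p | p permutes {0..<n}.
      signof p * (\<Prod>i = 0..<n. M \<tau> t $$ (i, p i)))"
  proof (rule poly_family_sum)
    fix p assume "p \<in> {p. p permutes {0..<n}}"
    then have p: "p i < n" if "i < n" for i
      using that permutes_in_image[of p "{0..<n}" i] by auto
    have "poly_family x (card {0..<n} * 1) (\<lambda>\<tau> t. \<Prod>i = 0..<n. M \<tau> t $$ (i, p i))"
      by (rule poly_family_prod) (use p assms(2) in auto)
    then have "poly_family x n (\<lambda>\<tau> t. \<Prod>i = 0..<n. M \<tau> t $$ (i, p i))" by simp
    from poly_family_mult[OF poly_family_const[of x 0] this]
    show "poly_family x n (\<lambda>\<tau> t. signof p * (\<Prod>i = 0..<n. M \<tau> t $$ (i, p i)))" by simp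
  qed
  then show ?thesis by (simp add: det_def'[OF assms(1)])
qed

text \<open>
  A cofactor is a determinant of order \<open>n - 1\<close>; the larger bound \<open>n\<close> lets determinant and
  cofactors share one degree.
\<close>

lemma poly_family_cofactor:
  assumes M: "\<And>\<tau> t. M \<tau> t \<in> carrier_mat n n"
    and ent: "\<And>i j. i < n \<Longrightarrow> j < n \<Longrightarrow> poly_family x 1 (\<lambda>\<tau> t. M \<tau> t $$ (i, j))"
    and "i < n" "j < n"
  shows "poly_family x n (\<lambda>\<tau> t. cofactor (M \<tau> t) i j)"
proof -
  have "poly_family x (n - 1) (\<lambda>\<tau> t. Determinant.det (mat_delete (M \<tau> t) i j))"
  proof (rule poly_family_det)
    show "mat_delete (M \<tau> t) i j \<in> carrier_mat (n - 1) (n - 1)" for \<tau> t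
      by (rule mat_delete_carrier[OF M])
    fix k l assume kl: "k < n - 1" "l < n - 1"
    have "dim_row (M \<tau> t) = n" "dim_col (M \<tau> t) = n" for \<tau> t using M[of \<tau> t] by auto
    then have "mat_delete (M \<tau> t) i j $$ (k, l) =
        M \<tau> t $$ (if k < i then k else Suc k, if l < j then l else Suc l)" for \<tau> t
      using kl by (simp add: mat_delete_def)
    moreover have "poly_family x 1 (\<lambda>\<tau> t.
        M \<tau> t $$ (if k < i then k else Suc k, if l < j then l else Suc l))"
      by (rule ent) (use kl in auto)
    ultimately show "poly_family x 1 (\<lambda>\<tau> t. mat_delete (M \<tau> t) i j $$ (k, l))" by simp
  qed
  from poly_family_mult[OF poly_family_const[of x 1 "(- 1) ^ (i + j)"] this]
  show ?thesis using assms(3) by (simp add: cofactor_def)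
qed

section \<open>Jacobi's formula\<close>

text \<open>
  By the product rule in Leibniz' expansion, the derivative is the sum over \<open>k\<close>
  of the determinants in which row \<open>k\<close> is replaced by its derivative. Laplace expansion along that
  row only involves cofactors that do not see the replacement.
\<close>

lemma det_has_derivative:
  fixes M :: "real \<Rightarrow> real mat"
  assumes M: "\<And>\<tau>. M \<tau> \<in> carrier_mat n n"
    and D: "\<And>i j. i < n \<Longrightarrow> j < n \<Longrightarrow> ((\<lambda>\<tau>. M \<tau> $$ (i, j)) has_real_derivative D i j) (at x)"
  shows "((\<lambda>\<tau>. Determinant.det (M \<tau>)) has_real_derivative
    (\<Sum>i<n. \<Sum>j<n. D i j * cofactor (M x) i j)) (at x)"
proof -
  let ?S = "{p. p permutes {0..<n}}"
  \<comment> \<open>\<open>R k\<close> is \<open>M x\<close> with row \<open>k\<close> replaced by its derivative.\<close>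
  define R where "R = (\<lambda>k. Matrix.mat n n (\<lambda>(i, j). if i = k then D i j else M x $$ (i, j)))"
  have Rc: "R k \<in> carrier_mat n n" for k by (simp add: R_def)
  have row: "Determinant.det (R k) = (\<Sum>j<n. D k j * cofactor (M x) k j)" if "k < n" for k
  proof -
    have "mat_delete (R k) k j = mat_delete (M x) k j" if "j < n" for j
      using M[of x] \<open>k < n\<close> that by (intro eq_matI) (auto simp: mat_delete_def R_def)
    then have "cofactor (R k) k j = cofactor (M x) k j" if "j < n" for j
      using that by (simp add: cofactor_def)
    then show ?thesis
      using that by (simp add: laplace_expansion_row[OF Rc that]) (simp add: R_def)
  qed
  have "((\<lambda>\<tau>. \<Sum>p\<in>?S. signof p * (\<Prod>i = 0..<n. M \<tau> $$ (i, p i))) has_real_derivative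
      (\<Sum>p\<in>?S. signof p * (\<Sum>k = 0..<n. D k (p k) * (\<Prod>i\<in>{0..<n} - {k}. M x $$ (i, p i))))) (at x)"
  proof (intro DERIV_sum DERIV_cmult has_field_derivative_prod)
    fix p k assume "p \<in> ?S" "k \<in> {0..<n}"
    then show "((\<lambda>\<tau>. M \<tau> $$ (k, p k)) has_real_derivative D k (p k)) (at x)"
      using permutes_in_image[of p "{0..<n}" k] by (intro D) auto
  qed
  also have "(\<Sum>p\<in>?S. signof p * (\<Sum>k = 0..<n. D k (p k) * (\<Prod>i\<in>{0..<n} - {k}. M x $$ (i, p i)))) =
      (\<Sum>p\<in>?S. \<Sum>k = 0..<n. signof p * (\<Prod>i = 0..<n. R k $$ (i, p i)))"
    unfolding sum_distrib_left
  proof (intro sum.cong refl arg_cong2[where f = "(*)"])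
    fix p k assume p: "p \<in> ?S" and k: "k \<in> {0..<n}"
    have pn: "p i < n" if "i < n" for i
      using that p permutes_in_image[of p "{0..<n}" i] by auto
    have "(\<Prod>i = 0..<n. R k $$ (i, p i)) = R k $$ (k, p k) * (\<Prod>i\<in>{0..<n} - {k}. R k $$ (i, p i))"
      by (rule prod.remove) (use k in auto)
    also have "(\<Prod>i\<in>{0..<n} - {k}. R k $$ (i, p i)) = (\<Prod>i\<in>{0..<n} - {k}. M x $$ (i, p i))"
      by (rule prod.cong) (auto simp: R_def pn)
    finally show "D k (p k) * (\<Prod>i\<in>{0..<n} - {k}. M x $$ (i, p i)) = (\<Prod>i = 0..<n. R k $$ (i, p i))"
      using k pn by (simp add: R_def)
  qed
  also have "\<dots> = (\<Sum>k = 0..<n. Determinant.det (R k))"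
    by (subst sum.swap) (simp add: det_def'[OF Rc])
  also have "\<dots> = (\<Sum>i<n. \<Sum>j<n. D i j * cofactor (M x) i j)"
    by (simp add: row atLeast0LessThan)
  finally show ?thesis by (simp add: det_def'[OF M])
qed

section \<open>Endomorphisms in an orthonormal basis\<close>

lemma endo_eqI:
  assumes bs: "orthonormal_basis bs"
    and eq: "\<And>i j. i < length bs \<Longrightarrow> j < length bs \<Longrightarrow>
      inner (bs ! i) (blinfun_apply f (bs ! j)) = inner (bs ! i) (blinfun_apply g (bs ! j))"
  shows "f = g"
proof (rule blinfun_eqI)
  fix x
  have b: "blinfun_apply f (bs ! j) = blinfun_apply g (bs ! j)" if "j < length bs" for j
  proof -
    have "(\<Sum>i<length bs. inner (bs ! i) (blinfun_apply f (bs ! j)) *\<^sub>R bs ! i) =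
        (\<Sum>i<length bs. inner (bs ! i) (blinfun_apply g (bs ! j)) *\<^sub>R bs ! i)"
      using that by (intro sum.cong refl) (simp only: eq lessThan_iff)
    then show ?thesis unfolding orthonormal_basis_expand[OF bs] .
  qed
  have "blinfun_apply f (\<Sum>j<length bs. inner (bs ! j) x *\<^sub>R bs ! j) =
      blinfun_apply g (\<Sum>j<length bs. inner (bs ! j) x *\<^sub>R bs ! j)"
    unfolding blinfun.sum_right blinfun.scaleR_right
    by (intro sum.cong refl) (simp only: b lessThan_iff)
  then show "blinfun_apply f x = blinfun_apply g x"
    unfolding orthonormal_basis_expand[OF bs] .
qed

lemma inner_compose_expand:
  assumes "orthonormal_basis bs"
  shows "inner x (blinfun_apply (f o\<^sub>L g) y) =
    (\<Sum>k<length bs. inner x (blinfun_apply f (bs ! k)) * inner (bs ! k) (blinfun_apply g y))"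
proof -
  have "inner x (blinfun_apply f (blinfun_apply g y)) = inner x (blinfun_apply f
      (\<Sum>k<length bs. inner (bs ! k) (blinfun_apply g y) *\<^sub>R bs ! k))"
    by (simp add: orthonormal_basis_expand[OF assms])
  then show ?thesis
    by (simp add: blinfun.sum_right blinfun.scaleR_right inner_sum_right mult.commute)
qed

text \<open>
  The endomorphism whose matrix in the orthonormal basis \<open>bs\<close> is \<open>m\<close>, as a sum of rank one maps.
\<close>

definition endo_of_coords :: "'v::real_inner list \<Rightarrow> (nat \<Rightarrow> nat \<Rightarrow> real) \<Rightarrow> 'v \<Rightarrow>\<^sub>L 'v" where
  "endo_of_coords bs m = (\<Sum>i<length bs. \<Sum>j<length bs.
     m i j *\<^sub>R (blinfun_scaleR_left (bs ! i) o\<^sub>L blinfun_inner_right (bs ! j)))"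

lemma inner_endo_of_coords:
  assumes bs: "orthonormal_basis bs" and kl: "k < length bs" "l < length bs"
  shows "inner (bs ! k) (blinfun_apply (endo_of_coords bs m) (bs ! l)) = m k l"
proof -
  have on: "\<And>i j. i < length bs \<Longrightarrow> j < length bs \<Longrightarrow>
      inner (bs ! i) (bs ! j) = (if i = j then 1 else 0)"
    using bs by (auto simp: orthonormal_basis_def)
  have "inner (bs ! k) (blinfun_apply (endo_of_coords bs m) (bs ! l)) =
      (\<Sum>i<length bs. \<Sum>j<length bs. m i j * (inner (bs ! j) (bs ! l) * inner (bs ! k) (bs ! i)))"
    by (simp add: endo_of_coords_def blinfun.sum_left blinfun.scaleR_left inner_sum_right mult.assoc)
  also have "\<dots> = (\<Sum>i<length bs. \<Sum>j<length bs. if j = l then (if i = k then m k l else 0) else 0)"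
    using kl by (intro sum.cong) (auto simp: on)
  also have "\<dots> = m k l" using kl by simp
  finally show ?thesis .
qed

lemma endo_trace_compose:
  assumes "orthonormal_basis bs"
  shows "endo_trace (f o\<^sub>L g) = (\<Sum>i<length bs. \<Sum>k<length bs.
    inner (bs ! i) (blinfun_apply f (bs ! k)) * inner (bs ! k) (blinfun_apply g (bs ! i)))"
  unfolding endo_trace_eq[OF assms] inner_compose_expand[OF assms] ..

text \<open>
  Pairing with the elementary endomorphism that sends \<open>bs ! k\<close> to \<open>bs ! l\<close> and the other basis
  vectors to 0 reads off the matrix entry \<open>(k, l)\<close>.
\<close>

lemma trace_form_nondegenerate:
  fixes g h :: "'v::real_inner \<Rightarrow>\<^sub>L 'v"
  assumes bs: "orthonormal_basis (bs :: 'v list)"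
    and eq: "\<And>f. endo_trace (f o\<^sub>L g) = endo_trace (f o\<^sub>L h)"
  shows "g = h"
proof (rule endo_eqI[OF bs])
  fix k l assume kl: "k < length bs" "l < length bs"
  let ?f = "endo_of_coords bs (\<lambda>i j. if j = k then if i = l then 1 else 0 else 0)"
  have tr: "endo_trace (?f o\<^sub>L e) = inner (bs ! k) (blinfun_apply e (bs ! l))" for e
  proof -
    have "endo_trace (?f o\<^sub>L e) = (\<Sum>i<length bs. \<Sum>j<length bs.
        if j = k then if i = l then inner (bs ! k) (blinfun_apply e (bs ! l)) else 0 else 0)"
      unfolding endo_trace_compose[OF bs]
    proof (intro sum.cong refl)
      fix i j assume "i \<in> {..<length bs}" "j \<in> {..<length bs}"
      then show "inner (bs ! i) (blinfun_apply ?f (bs ! j)) * inner (bs ! j) (blinfun_apply e (bs ! i)) =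
          (if j = k then if i = l then inner (bs ! k) (blinfun_apply e (bs ! l)) else 0 else 0)"
        by (simp add: inner_endo_of_coords[OF bs])
    qed
    then show ?thesis using kl by simp
  qed
  show "inner (bs ! k) (blinfun_apply g (bs ! l)) = inner (bs ! k) (blinfun_apply h (bs ! l))"
    using eq[of ?f] by (simp only: tr)
qed

section \<open>The pencil and its determinant\<close>

definition pencil ::
  "('q::finite \<Rightarrow> 'v::real_inner \<Rightarrow>\<^sub>L 'v) \<Rightarrow> ('q \<Rightarrow> real) \<Rightarrow> 'v \<Rightarrow>\<^sub>L 'v" where
  "pencil A t = id_blinfun + (\<Sum>\<alpha>\<in>UNIV. t \<alpha> *\<^sub>R A \<alpha>)"

lemma endo_mat_carrier [simp]: "endo_mat bs f \<in> carrier_mat (length bs) (length bs)"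
  by (simp add: endo_mat_def)

lemma endo_mat_index [simp]: "i < length bs \<Longrightarrow> j < length bs \<Longrightarrow>
    endo_mat bs f $$ (i, j) = inner (bs ! i) (blinfun_apply f (bs ! j))"
  by (simp add: endo_mat_def)

lemma inner_pencil:
  assumes bs: "orthonormal_basis bs" and "i < length bs" "j < length bs"
  shows "inner (bs ! i) (blinfun_apply (pencil A t) (bs ! j)) =
    (if i = j then 1 else 0) + (\<Sum>\<alpha>\<in>UNIV. t \<alpha> * inner (bs ! i) (blinfun_apply (A \<alpha>) (bs ! j)))"
  using assms by (simp add: pencil_def orthonormal_basis_def blinfun.add_left blinfun.sum_left
      blinfun.scaleR_left inner_add_right inner_sum_right)

lemma has_real_derivative_inner_endo:
  assumes "(f has_vector_derivative f') (at x)"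
  shows "((\<lambda>\<tau>. inner a (blinfun_apply (f \<tau>) b)) has_real_derivative
    inner a (blinfun_apply f' b)) (at x)"
proof -
  have "bounded_linear (\<lambda>g. inner a (blinfun_apply g b))"
    by (intro bounded_linear_intros)
  from bounded_linear.has_vector_derivative[OF this assms] show ?thesis
    by (simp add: has_real_derivative_iff_has_vector_derivative)
qed

lemma poly_family_pencil_entry:
  assumes bs: "orthonormal_basis bs" and ij: "i < length bs" "j < length bs"
    and c: "\<And>\<alpha>. ((\<lambda>\<tau>. c \<tau> \<alpha>) has_vector_derivative c' \<alpha>) (at x)"
  shows "poly_family x 1 (\<lambda>\<tau> t. endo_mat bs (pencil (c \<tau>) t) $$ (i, j))"
proof -
  have "(\<lambda>\<tau>. inner (bs ! i) (blinfun_apply (c \<tau> \<alpha>) (bs ! j))) differentiable (at x)" for \<alpha>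
    using has_real_derivative_inner_endo[OF c] by (auto simp: real_differentiable_def)
  then have "poly_family x (1 + 0) (\<lambda>\<tau> t. t \<alpha> * inner (bs ! i) (blinfun_apply (c \<tau> \<alpha>) (bs ! j)))" for \<alpha>
    by (intro poly_family_mult poly_family_var poly_family_coeff)
  then have "poly_family x 1 (\<lambda>\<tau> t. (if i = j then 1 else 0) +
      (\<Sum>\<alpha>\<in>UNIV. t \<alpha> * inner (bs ! i) (blinfun_apply (c \<tau> \<alpha>) (bs ! j))))"
    by (intro poly_family_add poly_family_const poly_family_sum) auto
  then show ?thesis using ij by (simp add: inner_pencil[OF bs])
qed

text \<open>
  This family supplies both the existence of the coefficients \<open>\<sigma>\<^sub>u\<close>, through constant curves, and
  their differentiability along arbitrary curves.
\<close>

lemma poly_family_pencil_det: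
  fixes c :: "real \<Rightarrow> 'q::finite \<Rightarrow> 'v::real_inner \<Rightarrow>\<^sub>L 'v"
  assumes bs: "orthonormal_basis (bs :: 'v list)"
    and c: "\<And>\<alpha>. ((\<lambda>\<tau>. c \<tau> \<alpha>) has_vector_derivative c' \<alpha>) (at x)"
  shows "poly_family x (length bs) (\<lambda>\<tau> t. endo_det (pencil (c \<tau>) t))"
  unfolding endo_det_eq[OF bs]
  by (rule poly_family_det[OF endo_mat_carrier])
    (rule poly_family_pencil_entry[where c' = c', OF bs _ _ c])

text \<open>
  The description of \<open>sigma_nat\<close> determines it, since the coefficients of a polynomial function are
  unique; hence any coefficients that represent the determinant are the \<open>\<sigma>\<^sub>u\<close>.
\<close>

lemma sigma_nat_eqI:
  fixes A :: "'q::finite \<Rightarrow> 'v::real_inner \<Rightarrow>\<^sub>L 'v"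
  assumes van: "\<And>u. dim (UNIV :: 'v set) < mdeg u \<Longrightarrow> c u = 0"
    and ev: "\<And>t. endo_det (pencil A t) = poly_eval (dim (UNIV :: 'v set)) c t"
  shows "sigma_nat A = c"
  unfolding sigma_nat_def
proof (rule the_equality)
  show "(\<forall>u. mdeg u > dim (UNIV :: 'v set) \<longrightarrow> c u = 0) \<and>
     (\<forall>t :: 'q \<Rightarrow> real. endo_det (id_blinfun + (\<Sum>\<alpha>\<in>UNIV. t \<alpha> *\<^sub>R A \<alpha>)) =
        (\<Sum>u | mdeg u \<le> dim (UNIV :: 'v set). c u * (\<Prod>\<alpha>\<in>UNIV. t \<alpha> ^ u \<alpha>)))"
    using van ev by (simp add: pencil_def poly_eval_def mpow_def)
next
  fix b
  assume b: "(\<forall>u. mdeg u > dim (UNIV :: 'v set) \<longrightarrow> b u = 0) \<and>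
     (\<forall>t :: 'q \<Rightarrow> real. endo_det (id_blinfun + (\<Sum>\<alpha>\<in>UNIV. t \<alpha> *\<^sub>R A \<alpha>)) =
        (\<Sum>u | mdeg u \<le> dim (UNIV :: 'v set). b u * (\<Prod>\<alpha>\<in>UNIV. t \<alpha> ^ u \<alpha>)))"
  then have "poly_eval (dim (UNIV :: 'v set)) b t = poly_eval (dim (UNIV :: 'v set)) c t" for t
    using ev[of t] by (simp add: pencil_def poly_eval_def mpow_def)
  from poly_coeffs_unique[OF this _ van] show "b = c" using b by (intro ext) auto
qed

lemma
  fixes A :: "'q::finite \<Rightarrow> 'v::real_inner \<Rightarrow>\<^sub>L 'v"
  assumes bs: "orthonormal_basis (bs :: 'v list)"
  shows endo_det_pencil: "endo_det (pencil A t) = poly_eval (length bs) (sigma_nat A) t"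
    and sigma_nat_vanish: "length bs < mdeg u \<Longrightarrow> sigma_nat A u = 0"
proof -
  have "poly_family 0 (length bs) (\<lambda>\<tau> t. endo_det (pencil A t))"
    by (rule poly_family_pencil_det[OF bs, of "\<lambda>_. A" "\<lambda>_. 0"]) simp
  then obtain c :: "real \<Rightarrow> ('q \<Rightarrow> nat) \<Rightarrow> real" where c: "\<And>\<tau> u. length bs < mdeg u \<Longrightarrow> c \<tau> u = 0"
      "\<And>\<tau> t. endo_det (pencil A t) = poly_eval (length bs) (c \<tau>) t"
    by (rule poly_familyE) blast
  have "sigma_nat A = c (0::real)"
    by (rule sigma_nat_eqI) (use c orthonormal_basis_dim[OF bs] in auto)
  then show "endo_det (pencil A t) = poly_eval (length bs) (sigma_nat A) t"
    and "length bs < mdeg u \<Longrightarrow> sigma_nat A u = 0"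
    using c by auto
qed

section \<open>The adjugate of the pencil\<close>

text \<open>
  \<open>adj (1 + tA) = \<Sum>\<^sub>w T\<^sub>w t\<^sup>w\<close>, expressed through the matrix entries in the basis \<open>bs\<close>.
\<close>

definition adjugate_coeffs ::
  "'v::real_inner list \<Rightarrow> ('q::finite \<Rightarrow> 'v \<Rightarrow>\<^sub>L 'v) \<Rightarrow> (('q \<Rightarrow> nat) \<Rightarrow> 'v \<Rightarrow>\<^sub>L 'v) \<Rightarrow> bool" where
  "adjugate_coeffs bs A T \<longleftrightarrow> (\<forall>w. length bs < mdeg w \<longrightarrow> T w = 0) \<and>
     (\<forall>t. \<forall>i<length bs. \<forall>j<length bs. adj_mat (endo_mat bs (pencil A t)) $$ (i, j) =
        poly_eval (length bs) (\<lambda>w. inner (bs ! i) (blinfun_apply (T w) (bs ! j))) t)"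

lemma adj_mat_index: "M \<in> carrier_mat n n \<Longrightarrow> i < n \<Longrightarrow> j < n \<Longrightarrow> adj_mat M $$ (i, j) = cofactor M j i"
  by (auto simp: adj_mat_def)

lemma ex_adjugate_coeffs:
  fixes bs :: "'v::real_inner list" and A :: "'q::finite \<Rightarrow> 'v \<Rightarrow>\<^sub>L 'v"
  assumes bs: "orthonormal_basis bs"
  shows "\<exists>T. adjugate_coeffs bs A T"
proof -
  have "\<exists>c. (\<forall>u. length bs < mdeg u \<longrightarrow> c u = 0) \<and>
      (\<forall>t. cofactor (endo_mat bs (pencil A t)) j i = poly_eval (length bs) c t)"
    if ij: "i < length bs" "j < length bs" for i j
  proof -
    have "poly_family 0 (length bs) (\<lambda>\<tau> t. cofactor (endo_mat bs (pencil A t)) j i)"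
      by (rule poly_family_cofactor[OF endo_mat_carrier
            poly_family_pencil_entry[OF bs _ _, of _ _ "\<lambda>_. A" "\<lambda>_. 0"]]) (use ij in auto)
    then show ?thesis by (rule poly_familyE) blast
  qed
  then obtain g where g: "\<And>i j u. i < length bs \<Longrightarrow> j < length bs \<Longrightarrow> length bs < mdeg u \<Longrightarrow> g i j u = 0"
      "\<And>i j t. i < length bs \<Longrightarrow> j < length bs \<Longrightarrow>
        cofactor (endo_mat bs (pencil A t)) j i = poly_eval (length bs) (g i j) t"
    by metis
  define T where "T w = endo_of_coords bs (\<lambda>i j. g i j w)" for w
  have entry: "inner (bs ! i) (blinfun_apply (T w) (bs ! j)) = g i j w"
    if "i < length bs" "j < length bs" for i j w
    unfolding T_def by (rule inner_endo_of_coords[OF bs that])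
  have "adjugate_coeffs bs A T"
    unfolding adjugate_coeffs_def
  proof (intro conjI allI impI)
    show "T w = 0" if "length bs < mdeg w" for w
      by (rule endo_eqI[OF bs]) (simp add: entry g(1) that)
  next
    fix t i j assume ij: "i < length bs" "j < length bs"
    show "adj_mat (endo_mat bs (pencil A t)) $$ (i, j) =
        poly_eval (length bs) (\<lambda>w. inner (bs ! i) (blinfun_apply (T w) (bs ! j))) t"
      unfolding adj_mat_index[OF endo_mat_carrier ij] g(2)[OF ij] entry[OF ij] ..
  qed
  then show ?thesis by (intro exI[of _ T])
qed

text \<open>
  This is the coefficient of \<open>t\<^sup>u\<close> in Cramer's rule \<open>(1 + tA) adj (1 + tA) = det (1 + tA) 1\<close>. The
  comparison is made for each matrix entry, with the polynomials on both sides regarded as having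
  degree at most \<open>n + 1\<close>, the bound for the left side.
\<close>

lemma adjugate_coeffs_rec:
  fixes bs :: "'v::real_inner list" and A :: "'q::finite \<Rightarrow> 'v \<Rightarrow>\<^sub>L 'v"
  assumes bs: "orthonormal_basis bs" and T: "adjugate_coeffs bs A T"
  shows "T u = sigma_nat A u *\<^sub>R id_blinfun - (\<Sum>\<alpha>\<in>UNIV. A \<alpha> o\<^sub>L ext_zero T (flat \<alpha> u))"
proof -
  let ?n = "length bs"
  have van: "T w = 0" if "?n < mdeg w" for w using T that unfolding adjugate_coeffs_def by blast
  have "T u + (\<Sum>\<alpha>\<in>UNIV. A \<alpha> o\<^sub>L ext_zero T (flat \<alpha> u)) = sigma_nat A u *\<^sub>R id_blinfun"
  proof (rule endo_eqI[OF bs])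
    fix i j assume ij: "i < ?n" "j < ?n"
    define coord where "coord f = inner (bs ! i) (blinfun_apply f (bs ! j))" for f :: "'v \<Rightarrow>\<^sub>L 'v"
    have coord_add: "coord (f + g) = coord f + coord g" for f g
      by (simp add: coord_def blinfun.add_left inner_add_right)
    have coord_sum: "coord (sum f UNIV) = (\<Sum>\<alpha>\<in>UNIV. coord (f \<alpha>))" for f :: "'q \<Rightarrow> _"
      by (simp add: coord_def blinfun.sum_left inner_sum_right)
    have coord_scaleR: "coord (r *\<^sub>R f) = r * coord f" for r f
      by (simp add: coord_def blinfun.scaleR_left)
    have coord0: "coord 0 = 0" by (simp add: coord_def)
    have "poly_eval (Suc ?n) (\<lambda>u. coord (T u + (\<Sum>\<alpha>\<in>UNIV. A \<alpha> o\<^sub>L ext_zero T (flat \<alpha> u)))) t =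
        poly_eval (Suc ?n) (\<lambda>u. coord (sigma_nat A u *\<^sub>R id_blinfun)) t" for t
    proof -
      let ?M = "endo_mat bs (pencil A t)"
      have shift: "t \<alpha> * poly_eval ?n (\<lambda>w. coord (A \<alpha> o\<^sub>L T w)) t =
          poly_eval (Suc ?n) (\<lambda>u. coord (A \<alpha> o\<^sub>L ext_zero T (flat \<alpha> u))) t" for \<alpha>
        unfolding poly_eval_shift by (subst ext_zero_map) (simp_all add: coord0)
      have "(\<Sum>k<?n. ?M $$ (i, k) * adj_mat ?M $$ (k, j)) = (?M * adj_mat ?M) $$ (i, j)"
        using ij adj_mat(1)[OF endo_mat_carrier[of bs "pencil A t"]]
        by (simp add: scalar_prod_def atLeast0LessThan endo_mat_def del: endo_mat_index)
      also have "\<dots> = endo_det (pencil A t) * (if i = j then 1 else 0)"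
        using ij by (simp add: adj_mat(2)[OF endo_mat_carrier] endo_det_eq[OF bs])
      also have "\<dots> = poly_eval (Suc ?n) (\<lambda>u. coord (sigma_nat A u *\<^sub>R id_blinfun)) t"
      proof -
        have "coord id_blinfun = (if i = j then 1 else 0)"
          using bs ij by (simp add: coord_def orthonormal_basis_def)
        then show ?thesis
          using poly_eval_mono[of ?n "sigma_nat A" "Suc ?n" t, OF sigma_nat_vanish[OF bs]]
            endo_det_pencil[OF bs, of A t]
            poly_eval_cmult[of "Suc ?n" "if i = j then 1 else 0" "sigma_nat A" t]
          by (simp only: coord_scaleR mult.commute le_SucI order_refl)
      qed
      finally have det: "(\<Sum>k<?n. ?M $$ (i, k) * adj_mat ?M $$ (k, j)) =
          poly_eval (Suc ?n) (\<lambda>u. coord (sigma_nat A u *\<^sub>R id_blinfun)) t" .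
      let ?e = "\<lambda>k. poly_eval ?n (\<lambda>w. inner (bs ! k) (blinfun_apply (T w) (bs ! j))) t"
      have "(\<Sum>k<?n. ?M $$ (i, k) * adj_mat ?M $$ (k, j)) =
          (\<Sum>k<?n. (if i = k then 1 else 0) * ?e k +
            (\<Sum>\<alpha>\<in>UNIV. t \<alpha> * (inner (bs ! i) (blinfun_apply (A \<alpha>) (bs ! k)) * ?e k)))"
        using T ij by (intro sum.cong)
          (auto simp: adjugate_coeffs_def inner_pencil[OF bs] distrib_right sum_distrib_right mult.assoc)
      also have "\<dots> = ?e i + (\<Sum>\<alpha>\<in>UNIV. \<Sum>k<?n.
          t \<alpha> * (inner (bs ! i) (blinfun_apply (A \<alpha>) (bs ! k)) * ?e k))"
      proof -
        have "(\<Sum>k<?n. (if i = k then 1 else 0) * ?e k) = (\<Sum>k<?n. if i = k then ?e k else 0)"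
          by (intro sum.cong) auto
        then show ?thesis using ij by (simp add: sum.distrib) (rule sum.swap)
      qed
      also have "?e i = poly_eval (Suc ?n) (\<lambda>w. coord (T w)) t"
        unfolding coord_def by (rule poly_eval_mono[symmetric]) (simp_all add: van)
      also have "(\<Sum>\<alpha>\<in>UNIV. \<Sum>k<?n. t \<alpha> * (inner (bs ! i) (blinfun_apply (A \<alpha>) (bs ! k)) * ?e k)) =
          (\<Sum>\<alpha>\<in>UNIV. t \<alpha> * poly_eval ?n (\<lambda>w. coord (A \<alpha> o\<^sub>L T w)) t)"
        unfolding coord_def inner_compose_expand[OF bs] poly_eval_sum poly_eval_cmult
        by (simp add: sum_distrib_left)
      also have "poly_eval (Suc ?n) (\<lambda>w. coord (T w)) t + \<dots> =
          poly_eval (Suc ?n) (\<lambda>u. coord (T u + (\<Sum>\<alpha>\<in>UNIV. A \<alpha> o\<^sub>L ext_zero T (flat \<alpha> u)))) t"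
        by (simp only: shift coord_add coord_sum poly_eval_add poly_eval_sum)
      finally show ?thesis using det by simp
    qed
    then have "coord (T u + (\<Sum>\<alpha>\<in>UNIV. A \<alpha> o\<^sub>L ext_zero T (flat \<alpha> u))) =
        coord (sigma_nat A u *\<^sub>R id_blinfun)"
    proof (rule poly_coeffs_unique)
      fix u :: "'q \<Rightarrow> nat" assume u: "Suc ?n < mdeg u"
      show "coord (T u + (\<Sum>\<alpha>\<in>UNIV. A \<alpha> o\<^sub>L ext_zero T (flat \<alpha> u))) = 0"
        using u by (simp add: van ext_zero_flat_vanish[OF van u] coord0)
      show "coord (sigma_nat A u *\<^sub>R id_blinfun) = 0"
        using u by (simp add: sigma_nat_vanish[OF bs] coord0)
    qed
    then show "inner (bs ! i) (blinfun_apply (T u + (\<Sum>\<alpha>\<in>UNIV. A \<alpha> o\<^sub>L ext_zero T (flat \<alpha> u))) (bs ! j)) =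
        inner (bs ! i) (blinfun_apply (sigma_nat A u *\<^sub>R id_blinfun) (bs ! j))"
      by (simp add: coord_def)
  qed
  then show ?thesis by (simp add: algebra_simps)
qed

section \<open>The defining property and uniqueness\<close>

lemma smooth_curve_on_vector_derivative:
  assumes "smooth_curve_on S c" "open S" "x \<in> S"
  shows "(c has_vector_derivative vector_derivative c (at x)) (at x)"
proof -
  obtain D where D: "\<And>\<tau>. \<tau> \<in> S \<Longrightarrow> D 0 \<tau> = c \<tau>"
      "\<And>n \<tau>. \<tau> \<in> S \<Longrightarrow> (D n has_vector_derivative D (Suc n) \<tau>) (at \<tau>)"
    using assms(1) unfolding smooth_curve_on_def by blast
  have "(c has_vector_derivative D (Suc 0) x) (at x)"
    by (rule has_vector_derivative_transform_within_open[OF D(2) assms(2,3) D(1)]) (use assms in auto)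
  then show ?thesis
    using differentiableI_vector vector_derivative_works by blast
qed

text \<open>
  Both sides of the claim are coefficients of \<open>t\<^sup>u\<close> in the derivative of \<open>det (1 + t c(\<tau>))\<close> at
  \<open>\<tau> = 0\<close>: on the left because the coefficients form a polynomial family, on the right by Jacobi's
  formula.
\<close>

lemma adjugate_coeffs_newton:
  fixes bs :: "'v::real_inner list" and A :: "'q::finite \<Rightarrow> 'v \<Rightarrow>\<^sub>L 'v"
  assumes bs: "orthonormal_basis bs" and T: "adjugate_coeffs bs A T"
  shows "generalized_newton_transformation A T"
  unfolding generalized_newton_transformation_def
proof (intro allI impI, elim conjE)
  fix u and c :: "real \<Rightarrow> 'q \<Rightarrow> 'v \<Rightarrow>\<^sub>L 'v" and \<epsilon> :: real
  assume \<epsilon>: "0 < \<epsilon>" and sm: "\<forall>\<alpha>. smooth_curve_on {-\<epsilon><..<\<epsilon>} (\<lambda>\<tau>. c \<tau> \<alpha>)" and c0: "c 0 = A"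
  let ?n = "length bs"
  let ?B = "\<lambda>\<alpha>. vector_derivative (\<lambda>\<tau>. c \<tau> \<alpha>) (at 0)"
  have dc: "((\<lambda>\<tau>. c \<tau> \<alpha>) has_vector_derivative ?B \<alpha>) (at 0)" for \<alpha>
    by (rule smooth_curve_on_vector_derivative[OF sm[rule_format, of \<alpha>]]) (use \<epsilon> in auto)
  have "poly_family 0 ?n (\<lambda>\<tau> t. endo_det (pencil (c \<tau>) t))"
    by (rule poly_family_pencil_det[OF bs dc])
  then obtain k where k: "\<And>\<tau> u. ?n < mdeg u \<Longrightarrow> k \<tau> u = 0"
      "\<And>\<tau> t. endo_det (pencil (c \<tau>) t) = poly_eval ?n (k \<tau>) t"
      "\<And>u. (\<lambda>\<tau>. k \<tau> u) differentiable (at 0)"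
    by (rule poly_familyE) blast
  \<comment> \<open>Coefficients are unique, so the differentiable ones provided by the family are the \<open>\<sigma>\<^sub>u\<close>.\<close>
  have sk: "sigma_nat (c \<tau>) = k \<tau>" for \<tau>
    by (rule sigma_nat_eqI) (use k orthonormal_basis_dim[OF bs] in auto)
  define k' where "k' u = deriv (\<lambda>\<tau>. k \<tau> u) 0" for u
  have k': "((\<lambda>\<tau>. k \<tau> u) has_real_derivative k' u) (at 0)" for u
    using k(3)[of u] unfolding k'_def real_differentiable_def by (auto simp: DERIV_imp_deriv)
  let ?r = "\<lambda>u. \<Sum>\<alpha>\<in>UNIV. endo_trace (?B \<alpha> o\<^sub>L ext_zero T (flat \<alpha> u))"
  have tr0: "endo_trace (0 :: 'v \<Rightarrow>\<^sub>L 'v) = 0"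
    by (simp add: endo_trace_eq[OF bs])
  have "poly_eval (Suc ?n) k' t = poly_eval (Suc ?n) ?r t" for t
  proof -
    let ?M = "\<lambda>\<tau>. endo_mat bs (pencil (c \<tau>) t)"
    let ?D = "\<lambda>i j. \<Sum>\<alpha>\<in>UNIV. t \<alpha> * inner (bs ! i) (blinfun_apply (?B \<alpha>) (bs ! j))"
    have "((\<lambda>\<tau>. poly_eval (Suc ?n) (k \<tau>) t) has_real_derivative poly_eval (Suc ?n) k' t) (at 0)"
      unfolding poly_eval_def by (intro DERIV_sum DERIV_cmult_right k')
    moreover have "poly_eval (Suc ?n) (k \<tau>) t = Determinant.det (?M \<tau>)" for \<tau>
      using k(2)[of \<tau> t] poly_eval_mono[of ?n "k \<tau>" "Suc ?n" t, OF k(1)]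
      by (simp add: endo_det_eq[OF bs])
    moreover have "((\<lambda>\<tau>. Determinant.det (?M \<tau>)) has_real_derivative
        (\<Sum>i<?n. \<Sum>j<?n. ?D i j * cofactor (?M 0) i j)) (at 0)"
    proof (rule det_has_derivative[OF endo_mat_carrier])
      fix i j assume ij: "i < ?n" "j < ?n"
      show "((\<lambda>\<tau>. ?M \<tau> $$ (i, j)) has_real_derivative ?D i j) (at 0)"
        unfolding endo_mat_index[OF ij] inner_pencil[OF bs ij]
        by (rule DERIV_add[where D = 0, simplified])
          (intro DERIV_const DERIV_sum DERIV_cmult has_real_derivative_inner_endo dc)+
    qed
    ultimately have "poly_eval (Suc ?n) k' t = (\<Sum>i<?n. \<Sum>j<?n. ?D i j * cofactor (?M 0) i j)"
      using DERIV_unique by simp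
    also have "\<dots> = (\<Sum>i<?n. \<Sum>j<?n. \<Sum>\<alpha>\<in>UNIV. t \<alpha> * poly_eval ?n (\<lambda>w.
        inner (bs ! i) (blinfun_apply (?B \<alpha>) (bs ! j)) * inner (bs ! j) (blinfun_apply (T w) (bs ! i))) t)"
      unfolding sum_distrib_right
    proof (intro sum.cong refl)
      fix i j \<alpha> assume "i \<in> {..<?n}" "j \<in> {..<?n}"
      then have "cofactor (?M 0) i j =
          poly_eval ?n (\<lambda>w. inner (bs ! j) (blinfun_apply (T w) (bs ! i))) t"
        using T by (simp add: adjugate_coeffs_def adj_mat_index[OF endo_mat_carrier] c0)
      then show "t \<alpha> * inner (bs ! i) (blinfun_apply (?B \<alpha>) (bs ! j)) * cofactor (?M 0) i j =
          t \<alpha> * poly_eval ?n (\<lambda>w. inner (bs ! i) (blinfun_apply (?B \<alpha>) (bs ! j)) *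
            inner (bs ! j) (blinfun_apply (T w) (bs ! i))) t"
        by (simp add: poly_eval_cmult)
    qed
    also have "\<dots> = (\<Sum>\<alpha>\<in>UNIV. t \<alpha> * poly_eval ?n (\<lambda>w. endo_trace (?B \<alpha> o\<^sub>L T w)) t)"
      unfolding endo_trace_compose[OF bs] poly_eval_sum sum_distrib_left
      by (subst sum.swap[of _ UNIV], subst sum.swap[of _ UNIV]) (rule refl)
    also have "\<dots> = poly_eval (Suc ?n) ?r t"
      unfolding poly_eval_shift poly_eval_sum
      by (subst ext_zero_map[where F = T]) (simp_all add: tr0)
    finally show ?thesis .
  qed
  then have "k' u = ?r u"
  proof (rule poly_coeffs_unique)
    fix u :: "'q \<Rightarrow> nat" assume u: "Suc ?n < mdeg u"
    have "((\<lambda>\<tau>. k \<tau> u) has_real_derivative 0) (at 0)"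
      using u by (simp add: k(1))
    then show "k' u = 0" using DERIV_unique[OF k'] by blast
    have "T w = 0" if "?n < mdeg w" for w using T that unfolding adjugate_coeffs_def by blast
    from ext_zero_flat_vanish[of ?n T, OF this u] show "?r u = 0" by (simp add: tr0)
  qed
  then show "((\<lambda>\<tau>. sigma_int (c \<tau>) (\<lambda>\<alpha>. int (u \<alpha>))) has_real_derivative ?r u) (at 0)"
    using k'[of u] by (simp add: sigma_int_def sk)
qed

lemma smooth_curve_on_affine: "smooth_curve_on S (\<lambda>\<tau>. a + \<tau> *\<^sub>R b)"
proof -
  \<comment> \<open>the successive derivatives: the map itself, then the constant \<open>b\<close>, then 0\<close>
  let ?D = "\<lambda>n. case n of 0 \<Rightarrow> (\<lambda>\<tau>. a + \<tau> *\<^sub>R b) | Suc m \<Rightarrow> (\<lambda>_. if m = 0 then b else 0)"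
  have "(?D n has_vector_derivative ?D (Suc n) \<tau>) (at \<tau>)" for n \<tau>
    by (cases n) (auto intro!: derivative_eq_intros)
  then show ?thesis
    unfolding smooth_curve_on_def by (intro exI[of _ ?D]) simp
qed

text \<open>
  The line through \<open>A\<close> in direction \<open>f\<close> in the component \<open>\<alpha>\<close>, tested at the index \<open>u\<close> with
  \<open>flat \<alpha> u = w\<close>, has the derivative \<open>tr (f T\<^sub>w)\<close>. This determines \<open>T\<^sub>w\<close>, and every \<open>w\<close> arises in this
  way because the index type has an element \<open>\<alpha>\<close>.
\<close>

lemma newton_unique:
  fixes bs :: "'v::real_inner list" and A :: "'q::finite \<Rightarrow> 'v \<Rightarrow>\<^sub>L 'v"
  assumes bs: "orthonormal_basis bs"
    and T: "generalized_newton_transformation A T"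
    and T': "generalized_newton_transformation A T'"
  shows "T = T'"
proof
  fix w :: "'q \<Rightarrow> nat"
  obtain \<alpha> :: 'q where True by blast
  define u where "u = w(\<alpha> := Suc (w \<alpha>))"
  show "T w = T' w"
  proof (rule trace_form_nondegenerate[OF bs])
    fix f :: "'v \<Rightarrow>\<^sub>L 'v"
    let ?B = "\<lambda>\<beta>. if \<beta> = \<alpha> then f else 0"
    let ?c = "\<lambda>\<tau> \<beta>. A \<beta> + \<tau> *\<^sub>R ?B \<beta>"
    have vd: "vector_derivative (\<lambda>\<tau>. ?c \<tau> \<beta>) (at 0) = ?B \<beta>" for \<beta>
      by (rule vector_derivative_at) (auto intro!: derivative_eq_intros)
    have der: "((\<lambda>\<tau>. sigma_int (?c \<tau>) (\<lambda>\<alpha>. int (u \<alpha>))) has_real_derivative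
        endo_trace (f o\<^sub>L S w)) (at 0)" if "generalized_newton_transformation A S" for S
    proof -
      have "((\<lambda>\<tau>. sigma_int (?c \<tau>) (\<lambda>\<alpha>. int (u \<alpha>))) has_real_derivative
           (\<Sum>\<beta>\<in>UNIV. endo_trace
              (vector_derivative (\<lambda>\<tau>. ?c \<tau> \<beta>) (at 0) o\<^sub>L ext_zero S (flat \<beta> u)))) (at 0)"
        using that[unfolded generalized_newton_transformation_def, rule_format, of 1 ?c u]
        by (simp add: smooth_curve_on_affine)
      also have "(\<Sum>\<beta>\<in>UNIV. endo_trace
              (vector_derivative (\<lambda>\<tau>. ?c \<tau> \<beta>) (at 0) o\<^sub>L ext_zero S (flat \<beta> u))) =
          (\<Sum>\<beta>\<in>UNIV. if \<beta> = \<alpha> then endo_trace (f o\<^sub>L S w) else 0)"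
        unfolding vd
        by (intro sum.cong) (auto simp: ext_zero_flat u_def endo_trace_eq[OF bs])
      finally show ?thesis by simp
    qed
    show "endo_trace (f o\<^sub>L T w) = endo_trace (f o\<^sub>L T' w)"
      by (rule DERIV_unique[OF der[OF T] der[OF T']])
  qed
qed

section \<open>Words and the explicit formula\<close>

text \<open>
  The matrix in \<open>\<I>(q,s)\<close> that corresponds to a word \<open>\<alpha>\<^sub>1 \<dots> \<alpha>\<^sub>s\<close>: column \<open>l\<close> has its entry 1 in row
  \<open>\<alpha>\<^sub>l\<close>. Columns count from 1 and list positions from 0.
\<close>

definition word_mat :: "'q list \<Rightarrow> 'q \<Rightarrow> nat \<Rightarrow> nat" where
  "word_mat xs = (\<lambda>\<alpha> l. if l \<in> {1..length xs} \<and> xs ! (l - 1) = \<alpha> then 1 else 0)"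

definition word_prod :: "('q \<Rightarrow> 'v::real_inner \<Rightarrow>\<^sub>L 'v) \<Rightarrow> 'q list \<Rightarrow> 'v \<Rightarrow>\<^sub>L 'v" where
  "word_prod A xs = foldr (\<lambda>\<alpha> F. A \<alpha> o\<^sub>L F) xs id_blinfun"

lemma word_mat_eq_1_iff: "word_mat xs \<alpha> l = 1 \<longleftrightarrow> l \<in> {1..length xs} \<and> xs ! (l - 1) = \<alpha>"
  by (simp add: word_mat_def)

lemma bij_betw_word_mat: "bij_betw word_mat {xs :: 'q list. length xs = s} (index_mats s)"
  unfolding bij_betw_def
proof
  show "inj_on word_mat {xs :: 'q list. length xs = s}"
  proof (rule inj_onI)
    fix xs ys :: "'q list"
    assume len: "xs \<in> {xs. length xs = s}" "ys \<in> {xs. length xs = s}"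
      and eq: "word_mat xs = word_mat ys"
    show "xs = ys"
    proof (rule nth_equalityI)
      fix k assume k: "k < length xs"
      then have "word_mat ys (xs ! k) (Suc k) = 1"
        unfolding eq[symmetric] by (simp add: word_mat_def)
      then show "xs ! k = ys ! k" by (simp add: word_mat_def split: if_splits)
    qed (use len in simp)
  qed
  show "word_mat ` {xs :: 'q list. length xs = s} = index_mats s"
  proof (intro equalityI subsetI)
    fix i :: "'q \<Rightarrow> nat \<Rightarrow> nat" assume "i \<in> word_mat ` {xs. length xs = s}"
    then obtain xs where len: "length xs = s" and i: "i = word_mat xs" by blast
    have "\<exists>!\<alpha>. i \<alpha> l = 1" if "l \<in> {1..s}" for l
      using that unfolding i word_mat_eq_1_iff len by blast
    moreover have "i \<alpha> l \<in> {0, 1}" for \<alpha> l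
      unfolding i word_mat_def by simp
    moreover have "i \<alpha> l = 0" if "l \<notin> {1..s}" for \<alpha> l
      using that unfolding i word_mat_def len by (simp only: simp_thms if_False)
    ultimately show "i \<in> index_mats s"
      unfolding index_mats_def by blast
  next
    fix i :: "'q \<Rightarrow> nat \<Rightarrow> nat" assume i: "i \<in> index_mats s"
    let ?xs = "map (\<lambda>l. THE \<alpha>. i \<alpha> l = 1) [1..<Suc s]"
    have "i \<alpha> l = word_mat ?xs \<alpha> l" for \<alpha> l
    proof (cases "l \<in> {1..s}")
      case True
      then have ex1: "\<exists>!\<alpha>. i \<alpha> l = 1" and val: "i \<alpha> l = 0 \<or> i \<alpha> l = 1"
        using i by (auto simp: index_mats_def)
      have "l - 1 < length [1..<Suc s]" "[1..<Suc s] ! (l - 1) = l"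
        using True by (auto simp del: upt_Suc)
      then have nth: "?xs ! (l - 1) = (THE \<alpha>. i \<alpha> l = 1)" by (simp only: nth_map)
      have "?xs ! (l - 1) = \<alpha> \<longleftrightarrow> i \<alpha> l = 1"
        unfolding nth
      proof
        assume "(THE \<alpha>. i \<alpha> l = 1) = \<alpha>"
        with theI'[OF ex1] show "i \<alpha> l = 1" by (simp only:)
      qed (rule the1_equality[OF ex1])
      moreover have "l \<in> {1..length ?xs}" using True by simp
      ultimately have "word_mat ?xs \<alpha> l = (if i \<alpha> l = 1 then 1 else 0)"
        unfolding word_mat_def by (simp only: simp_thms)
      then show ?thesis using val by (elim disjE) (simp_all only: if_True if_False simp_thms zero_neq_one)
    next
      case False
      then have "i \<alpha> l = 0" using i by (simp add: index_mats_def)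
      moreover have "l \<notin> {1..length ?xs}" using False by simp
      ultimately show ?thesis unfolding word_mat_def by (simp only: simp_thms if_False)
    qed
    then have "i = word_mat ?xs" by (intro ext)
    moreover have "?xs \<in> {xs. length xs = s}" by simp
    ultimately show "i \<in> word_mat ` {xs. length xs = s}" by (rule image_eqI)
  qed
qed

lemma row_sums_word_mat:
  assumes "length xs = s"
  shows "row_sums s (word_mat xs) \<alpha> = count_list xs \<alpha>"
proof -
  have "row_sums s (word_mat xs) \<alpha> = (\<Sum>l<s. if xs ! l = \<alpha> then 1 else 0)"
    unfolding row_sums_def One_nat_def sum.atLeast1_atMost_eq
    by (rule sum.cong) (use assms in \<open>auto simp: word_mat_def\<close>)
  also have "\<dots> = card {l. l < s \<and> xs ! l = \<alpha>}"
    by (simp add: sum.If_cases lessThan_def Int_def)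
  also have "\<dots> = count_list xs \<alpha>"
    using assms by (simp add: count_list_eq_length_filter length_filter_conv_card eq_commute)
  finally show ?thesis .
qed

lemma total_sum_word_mat:
  fixes xs :: "'q::finite list"
  assumes "length xs = s"
  shows "total_sum s (word_mat xs) = s"
proof -
  have "total_sum s (word_mat xs) = (\<Sum>l=1..s. \<Sum>\<alpha>\<in>UNIV. word_mat xs \<alpha> l)"
    unfolding total_sum_def by (rule sum.swap)
  also have "\<dots> = (\<Sum>l=1..s. 1)"
  proof (rule sum.cong)
    fix l assume "l \<in> {1..s}"
    then have "word_mat xs \<alpha> l = (if xs ! (l - 1) = \<alpha> then 1 else 0)" for \<alpha>
      using assms by (simp add: word_mat_def)
    then show "(\<Sum>\<alpha>\<in>UNIV. word_mat xs \<alpha> l) = 1" by simp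
  qed simp
  finally show ?thesis by simp
qed

lemma endo_prod_word_mat:
  assumes "length xs = s"
  shows "endo_prod A s (word_mat xs) = word_prod A xs"
proof -
  have xs: "map (\<lambda>l. xs ! (l - 1)) [1..<Suc s] = xs"
    by (rule nth_equalityI) (use assms in \<open>simp_all del: upt_Suc\<close>)
  have "endo_prod A s (word_mat xs) =
      foldr (\<lambda>l F. A (xs ! (l - 1)) o\<^sub>L F) [1..<Suc s] id_blinfun"
    unfolding endo_prod_def
  proof (rule foldr_cong)
    fix F l assume "l \<in> set [1..<Suc s]"
    then have "(THE \<alpha>. word_mat xs \<alpha> l = 1) = xs ! (l - 1)"
      unfolding word_mat_eq_1_iff by (intro the_equality) (use assms in auto)
    then show "A (THE \<alpha>. word_mat xs \<alpha> l = 1) o\<^sub>L F = A (xs ! (l - 1)) o\<^sub>L F" by simp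
  qed simp_all
  also have "\<dots> = foldr (\<lambda>\<alpha> F. A \<alpha> o\<^sub>L F) (map (\<lambda>l. xs ! (l - 1)) [1..<Suc s]) id_blinfun"
    unfolding foldr_map comp_def ..
  finally show ?thesis unfolding xs word_prod_def .
qed

text \<open>
  The contribution of all words of length \<open>s\<close>, without its sign. The index is integral, so that
  the recursion in \<open>s\<close> needs no case distinction for negative entries.
\<close>

definition newton_level ::
  "('q::finite \<Rightarrow> 'v::real_inner \<Rightarrow>\<^sub>L 'v) \<Rightarrow> nat \<Rightarrow> ('q \<Rightarrow> int) \<Rightarrow> 'v \<Rightarrow>\<^sub>L 'v" where
  "newton_level A s v = (\<Sum>xs | length xs = s.
     sigma_int A (\<lambda>\<alpha>. v \<alpha> - int (count_list xs \<alpha>)) *\<^sub>R word_prod A xs)"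

lemma newton_level_index_mats:
  "(\<Sum>i\<in>index_mats s. ((-1) ^ total_sum s i * sigma_int A (\<lambda>\<alpha>. v \<alpha> - int (row_sums s i \<alpha>)))
      *\<^sub>R endo_prod A s i) = (-1) ^ s *\<^sub>R newton_level A s v"
proof -
  have "(\<Sum>i\<in>index_mats s. ((-1) ^ total_sum s i * sigma_int A (\<lambda>\<alpha>. v \<alpha> - int (row_sums s i \<alpha>)))
      *\<^sub>R endo_prod A s i) =
    (\<Sum>xs | length xs = s. ((-1) ^ total_sum s (word_mat xs) *
      sigma_int A (\<lambda>\<alpha>. v \<alpha> - int (row_sums s (word_mat xs) \<alpha>))) *\<^sub>R endo_prod A s (word_mat xs))"
    by (rule sum.reindex_bij_betw[OF bij_betw_word_mat, symmetric])
  also have "\<dots> = (-1) ^ s *\<^sub>R newton_level A s v"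
    unfolding newton_level_def scaleR_sum_right
    by (intro sum.cong refl)
      (simp add: row_sums_word_mat total_sum_word_mat endo_prod_word_mat)
  finally show ?thesis .
qed

lemma newton_level_0: "newton_level A 0 v = sigma_int A v *\<^sub>R id_blinfun"
  by (simp add: newton_level_def word_prod_def)

text \<open>
  Split a word into its first letter and the rest.
\<close>

lemma newton_level_Suc:
  fixes A :: "'q::finite \<Rightarrow> 'v::real_inner \<Rightarrow>\<^sub>L 'v"
  shows "newton_level A (Suc s) v = (\<Sum>\<alpha>\<in>UNIV. A \<alpha> o\<^sub>L newton_level A s (v(\<alpha> := v \<alpha> - 1)))"
proof -
  let ?f = "\<lambda>xs. sigma_int A (\<lambda>\<alpha>. v \<alpha> - int (count_list xs \<alpha>)) *\<^sub>R word_prod A xs"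
  have words: "{xs :: 'q list. length xs = Suc s} =
      (\<lambda>(\<alpha>, xs). \<alpha> # xs) ` (UNIV \<times> {xs. length xs = s})"
    by (auto simp: length_Suc_conv image_iff)
  have "newton_level A (Suc s) v = (\<Sum>(\<alpha>, xs)\<in>UNIV \<times> {xs. length xs = s}. ?f (\<alpha> # xs))"
    unfolding newton_level_def words
    by (subst sum.reindex) (auto simp: inj_on_def case_prod_unfold)
  also have "\<dots> = (\<Sum>\<alpha>\<in>UNIV. \<Sum>xs | length xs = s. ?f (\<alpha> # xs))"
    by (rule sum.cartesian_product[symmetric])
  also have "\<dots> = (\<Sum>\<alpha>\<in>UNIV. A \<alpha> o\<^sub>L newton_level A s (v(\<alpha> := v \<alpha> - 1)))"
  proof (intro sum.cong refl)
    fix \<alpha>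
    have "(\<lambda>\<beta>. v \<beta> - int (count_list (\<alpha> # xs) \<beta>)) =
        (\<lambda>\<beta>. (v(\<alpha> := v \<alpha> - 1)) \<beta> - int (count_list xs \<beta>))" for xs
      by (auto simp: fun_eq_iff)
    then have "?f (\<alpha> # xs) = A \<alpha> o\<^sub>L
        (sigma_int A (\<lambda>\<beta>. (v(\<alpha> := v \<alpha> - 1)) \<beta> - int (count_list xs \<beta>)) *\<^sub>R word_prod A xs)" for xs
      by (simp only: word_prod_def foldr.simps comp_apply
          bounded_bilinear.scaleR_right[OF bounded_bilinear_blinfun_compose])
    then show "(\<Sum>xs | length xs = s. ?f (\<alpha> # xs)) = A \<alpha> o\<^sub>L newton_level A s (v(\<alpha> := v \<alpha> - 1))"
      unfolding newton_level_def bounded_bilinear.sum_right[OF bounded_bilinear_blinfun_compose]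
      by (simp only:)
  qed
  finally show ?thesis .
qed

text \<open>
  With the zero convention, the recursion holds for all integral indices: if \<open>v\<close> has a negative
  entry, decreasing any entry leaves it negative, and all terms vanish.
\<close>

lemma ext_zero_rec:
  assumes rec: "\<And>u. T u = sigma_nat A u *\<^sub>R id_blinfun - (\<Sum>\<alpha>\<in>UNIV. A \<alpha> o\<^sub>L ext_zero T (flat \<alpha> u))"
  shows "ext_zero T v =
    sigma_int A v *\<^sub>R id_blinfun - (\<Sum>\<alpha>\<in>UNIV. A \<alpha> o\<^sub>L ext_zero T (v(\<alpha> := v \<alpha> - 1)))"
proof (cases "\<forall>\<alpha>. 0 \<le> v \<alpha>")
  case True
  define u where "u = (\<lambda>\<alpha>. nat (v \<alpha>))"
  have "flat \<alpha> u = v(\<alpha> := v \<alpha> - 1)" for \<alpha>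
    using True by (auto simp: flat_def u_def)
  then show ?thesis
    using rec[of u] True by (simp add: ext_zero_def[of _ v] sigma_int_def u_def)
next
  case False
  then obtain \<beta> where "v \<beta> < 0" by (auto simp: not_le)
  then have "(v(\<alpha> := v \<alpha> - 1)) \<beta> < 0" for \<alpha> by auto
  then have "ext_zero T (v(\<alpha> := v \<alpha> - 1)) = 0" for \<alpha>
    unfolding ext_zero_def using not_le by metis
  then show ?thesis using False by (simp only: ext_zero_def[of _ v] sigma_int_def) simp
qed

text \<open>
  Once the entries of the index add up to less than 0, one of them is negative and nothing is left.
  Each step of the recursion lowers this sum by one and contributes one level.
\<close>

lemma ext_zero_unroll:
  assumes rec: "\<And>u. T u = sigma_nat A u *\<^sub>R id_blinfun - (\<Sum>\<alpha>\<in>UNIV. A \<alpha> o\<^sub>L ext_zero T (flat \<alpha> u))"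
    and "(\<Sum>\<alpha>\<in>UNIV. v \<alpha>) < int m"
  shows "ext_zero T v = (\<Sum>s<m. (-1) ^ s *\<^sub>R newton_level A s v)"
  using assms(2)
proof (induction m arbitrary: v)
  case 0
  then have "\<not> (\<forall>\<alpha>. 0 \<le> v \<alpha>)" using sum_nonneg[of UNIV v] by force
  then show ?case by (auto simp: ext_zero_def)
next
  case (Suc m)
  have IH: "ext_zero T (v(\<alpha> := v \<alpha> - 1)) = (\<Sum>s<m. (-1) ^ s *\<^sub>R newton_level A s (v(\<alpha> := v \<alpha> - 1)))"
    for \<alpha>
  proof (rule Suc.IH)
    have "sum w UNIV = w \<alpha> + sum w (UNIV - {\<alpha>})" for w :: "_ \<Rightarrow> int"
      by (rule sum.remove) auto
    moreover have "sum (v(\<alpha> := v \<alpha> - 1)) (UNIV - {\<alpha>}) = sum v (UNIV - {\<alpha>})"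
      by (rule sum.cong) auto
    ultimately have "sum (v(\<alpha> := v \<alpha> - 1)) UNIV = sum v UNIV - 1"
      by (metis add_diff_eq add.commute fun_upd_same)
    then show "sum (v(\<alpha> := v \<alpha> - 1)) UNIV < int m"
      using Suc.prems by linarith
  qed
  have "(\<Sum>s<Suc m. (-1) ^ s *\<^sub>R newton_level A s v) = newton_level A 0 v +
      (\<Sum>s<m. (-1) ^ Suc s *\<^sub>R newton_level A (Suc s) v)"
    unfolding sum.lessThan_Suc_shift by simp
  also have "(\<Sum>s<m. (-1) ^ Suc s *\<^sub>R newton_level A (Suc s) v) =
      - (\<Sum>\<alpha>\<in>UNIV. \<Sum>s<m. (-1) ^ s *\<^sub>R (A \<alpha> o\<^sub>L newton_level A s (v(\<alpha> := v \<alpha> - 1))))"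
    by (subst sum.swap) (simp add: newton_level_Suc scaleR_sum_right sum_negf)
  also have "\<dots> = - (\<Sum>\<alpha>\<in>UNIV. A \<alpha> o\<^sub>L ext_zero T (v(\<alpha> := v \<alpha> - 1)))"
    unfolding IH bounded_bilinear.sum_right[OF bounded_bilinear_blinfun_compose]
      bounded_bilinear.scaleR_right[OF bounded_bilinear_blinfun_compose] ..
  finally show ?case
    using ext_zero_rec[OF rec, of v] by (simp add: newton_level_0)
qed

section \<open>Existence, uniqueness and the explicit formula\<close>

theorem theorem2p1:
  fixes A :: "'q::finite \<Rightarrow> 'v::real_inner \<Rightarrow>\<^sub>L 'v" and p :: nat
  assumes "\<exists>B :: 'v set. finite B \<and> independent B \<and> span B = UNIV \<and> card B = p"
  shows "(\<exists>!T. generalized_newton_transformation A T) \<and>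
    (\<forall>T. generalized_newton_transformation A T \<longrightarrow>
      (\<forall>u. T u = (\<Sum>s=0..mdeg u. \<Sum>i\<in>index_mats s.
        ((-1) ^ total_sum s i * sigma_int A (\<lambda>\<alpha>. int (u \<alpha>) - int (row_sums s i \<alpha>)))
          *\<^sub>R endo_prod A s i)))"
proof -
  obtain B :: "'v set" where "finite B" "span B = UNIV" using assms by blast
  then obtain bs :: "'v list" where bs: "orthonormal_basis bs"
    using ex_orthonormal_basis by blast
  obtain T where T: "adjugate_coeffs bs A T"
    using ex_adjugate_coeffs[OF bs] by blast
  have newton: "generalized_newton_transformation A T"
    by (rule adjugate_coeffs_newton[OF bs T])
  have unique: "T' = T" if "generalized_newton_transformation A T'" for T'
    by (rule newton_unique[OF bs that newton])
  have formula: "T u = (\<Sum>s=0..mdeg u. \<Sum>i\<in>index_mats s.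
        ((-1) ^ total_sum s i * sigma_int A (\<lambda>\<alpha>. int (u \<alpha>) - int (row_sums s i \<alpha>)))
          *\<^sub>R endo_prod A s i)" for u
  proof -
    have "(\<Sum>\<alpha>\<in>UNIV. int (u \<alpha>)) < int (Suc (mdeg u))" by (simp add: mdeg_def)
    from ext_zero_unroll[OF adjugate_coeffs_rec[OF bs T] this]
    show ?thesis
      unfolding newton_level_index_mats ext_zero_nat lessThan_Suc_atMost atLeast0AtMost .
  qed
  show ?thesis
  proof (intro conjI allI impI)
    show "\<exists>!T. generalized_newton_transformation A T"
      using newton unique by (rule ex1I)
  next
    fix T' u assume "generalized_newton_transformation A T'"
    then have "T' = T" by (rule unique)
    then show "T' u = (\<Sum>s=0..mdeg u. \<Sum>i\<in>index_mats s.
        ((-1) ^ total_sum s i * sigma_int A (\<lambda>\<alpha>. int (u \<alpha>) - int (row_sums s i \<alpha>)))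
          *\<^sub>R endo_prod A s i)"
      by (simp only: formula)
  qed
qed

end
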